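(* Let $I=(0,1)$ and let $\gamma=(\gamma_1,\gamma_2):I\to\mathbb{R}^2$ be a smooth regular curve. Let $\psi\in C_c^\infty(I)$ be nonnegative and not identically zero, and suppose $\gamma_1'(s)\neq 0$ and $\gamma_2'(s)\neq 0$ for all $s\in\operatorname{supp}\psi$. For functions $f,g$ on $\mathbb{R}$ define $$\mathcal{M}^{\gamma}(f,g)(x)=\sup_{t_1>0,\,t_2>0}\Big|\int f(x-t_1\gamma_1(s))\,g(x-t_2\gamma_2(s))\,\psi(s)\,ds\Big|,\qquad x\in\mathbb{R}.$$ Let $0<p,q\leq\infty$ and $1/r=1/p+1/q$. Then the estimate $$\|\mathcal{M}^{\gamma}(f,g)\|_{L^r(\mathbb{R})}\leq C\|f\|_{L^p(\mathbb{R})}\|g\|_{L^q(\mathbb{R})}$$ holds for all $f,g$ with a constant $C$ independent of $f,g$ if and only if $1<r\leq\infty$. *)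

theory Defs
  imports "HOL-Analysis.Analysis"
begin

definition smooth_on :: "real set \<Rightarrow> (real \<Rightarrow> real) \<Rightarrow> bool" where
  "smooth_on S f \<longleftrightarrow> (\<forall>k. \<forall>x\<in>S. ((deriv ^^ k) f) differentiable (at x))"

definition supp :: "(real \<Rightarrow> real) \<Rightarrow> real set" where
  "supp f = closure {x. f x \<noteq> 0}"

text \<open>Real power of an extended nonnegative real (exponent e > 0).\<close>
definition epow :: "ennreal \<Rightarrow> real \<Rightarrow> ennreal" where
  "epow a e = (if a = top then top else ennreal (enn2real a powr e))"

definition Lpn :: "ennreal \<Rightarrow> (real \<Rightarrow> ennreal) \<Rightarrow> ennreal" where
  "Lpn p h = (if p = top then Inf {c. AE x in lborel. h x \<le> c}
              else epow (\<integral>\<^sup>+ x. epow (h x) (enn2real p) \<partial>lborel) (1 / enn2real p))"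

definition Mgamma :: "(real \<Rightarrow> real) \<Rightarrow> (real \<Rightarrow> real) \<Rightarrow> (real \<Rightarrow> real)
    \<Rightarrow> (real \<Rightarrow> complex) \<Rightarrow> (real \<Rightarrow> complex) \<Rightarrow> real \<Rightarrow> ennreal" where
  "Mgamma \<gamma>1 \<gamma>2 \<psi> f g x =
     (SUP t\<in>{0<..} \<times> {0<..}.
        ennreal (norm (LINT s|lborel. f (x - fst t * \<gamma>1 s) * g (x - snd t * \<gamma>2 s)
                                       * complex_of_real (\<psi> s))))"

end

theory Submission
  imports Defs
begin

text \<open>If \<open>r > 1\<close> and \<open>f\<close>, \<open>g\<close> are normalised, Young's inequality with the conjugate exponents
  \<open>p / r\<close>, \<open>q / r\<close> gives \<open>|f g| \<le> |f|\<^sup>p\<^sup>/\<^sup>r + |g|\<^sup>q\<^sup>/\<^sup>r\<close>. Since neither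
  \<open>\<gamma>\<^sub>1'\<close> nor \<open>\<gamma>\<^sub>2'\<close> vanishes on the support of \<open>\<psi>\<close>, the substitution \<open>u = \<gamma>\<^sub>i s\<close> bounds the
  average of each summand along the dilated curve by a Hardy-Littlewood maximal function, which
  is bounded on \<open>L\<^sup>r\<close>. Conversely, if \<open>r \<le> 1\<close> and, say, \<open>p < \<infinity>\<close>, take \<open>f\<close> to be
  the indicator of \<open>[-1, 1]\<close> and \<open>g\<close> that of the unit neighbourhood of about \<open>N\<close> lacunary points:
  the maximal function is at least of order \<open>1 / |x|\<close> on a half-line up to \<open>|x| = 2\<^sup>N\<close>, so
  its \<open>L\<^sup>r\<close> norm is at least of order \<open>N\<^sup>1\<^sup>/\<^sup>r\<close>, against \<open>N\<^sup>1\<^sup>/\<^sup>q\<close> on the right.\<close>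

section \<open>Powers of extended nonnegative reals\<close>

text \<open>The two dilations are independent, so the points at which f and g are evaluated are
  unrelated. A sum, unlike a product, keeps one dilation in each term, and the two suprema decouple.
  Both summands lie in L^r, so the maximal theorem is invoked at the exponent r alone, and r > 1 is
  its range. The uncountable supremum over dilations is never shown to be measurable: it is compared
  pointwise with measurable functions. In the converse the obstacle is that dilations are positive.
  Steering the two curve points to 0 and to a centre y requires x and x - y to have the signs of the
  two coordinates of the curve. If these signs differ, y = 0 fails: y must lie beyond x, yet within
  distance |x| of it, so that the good parameters still fill a length of order 1 / |x|. One power of
  two serves a whole dyadic range of x, which is why N centres reach 2^N. The quotient of the two
  sides then grows like N^(1/p), so p must be finite; if p is infinite and q finite, f and g
  exchange roles.\<close>

lemma epow_mono: "a \<le> b \<Longrightarrow> 0 \<le> e \<Longrightarrow> epow a e \<le> epow b e"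
  unfolding epow_def
  by (auto simp: top_unique intro!: ennreal_leI powr_mono2 enn2real_mono simp: less_top)

lemma epow_ennreal: "0 \<le> a \<Longrightarrow> epow (ennreal a) e = ennreal (a powr e)"
  by (simp add: epow_def)

lemma epow_top: "epow top e = top"
  by (simp add: epow_def)

lemma epow_0 [simp]: "epow 0 e = 0"
  by (simp add: epow_def)

lemma epow_one [simp]: "epow 1 e = 1"
  using epow_ennreal[of 1 e] by simp

lemma epow_exponent_one [simp]: "epow a 1 = a"
  by (cases a) (auto simp: epow_ennreal epow_top)

lemma epow_eq_0_iff [simp]: "epow a e = 0 \<longleftrightarrow> a = 0"
  by (cases a) (auto simp: epow_ennreal epow_top)

lemma epow_mult: "0 < e \<Longrightarrow> epow (a * b) e = epow a e * epow b e"
  by (cases a; cases b)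
     (auto simp: epow_ennreal epow_top powr_mult ennreal_mult[symmetric] ennreal_mult_top ennreal_top_mult
        simp del: ennreal_mult)

lemma epow_epow: "epow (epow a d) e = epow a (d * e)"
  by (cases a) (auto simp: epow_ennreal epow_top powr_powr)

lemma borel_measurable_epow [measurable (raw)]:
  assumes [measurable]: "f \<in> borel_measurable M"
  shows "(\<lambda>x. epow (f x) e) \<in> borel_measurable M"
  unfolding epow_def by measurable

lemma epow_add_le:
  assumes "0 < e"
  shows "epow (a + b) e \<le> ennreal (2 powr e) * (epow a e + epow b e)"
proof -
  have "epow (a + b) e \<le> epow (2 * max a b) e"
    using assms by (intro epow_mono) (auto simp: mult_2 intro!: add_mono)
  also have "\<dots> = ennreal (2 powr e) * epow (max a b) e"
    using epow_ennreal[of 2 e] assms by (simp add: epow_mult)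
  also have "epow (max a b) e \<le> epow a e + epow b e"
    by (auto simp: max_def)
  finally show ?thesis by (simp add: mult_left_mono)
qed

section \<open>Layer cake formula for powers\<close>

lemma nn_integral_powr_Ioo:
  assumes e: "0 < e" and A: "0 \<le> A"
  shows "(\<integral>\<^sup>+ l. ennreal (l powr (e - 1)) * indicator {l. 0 < l \<and> l < A} l \<partial>lborel)
           = ennreal (A powr e / e)"
proof -
  have "((\<lambda>l. l powr (e - 1)) has_integral (A powr (e - 1 + 1) / (e - 1 + 1))) {0..A}"
    by (rule has_integral_powr_from_0) (use assms in auto)
  from nn_integral_has_integral_lebesgue[OF _ this]
  have "(\<integral>\<^sup>+ l. ennreal (indicator {0..A} l * l powr (e - 1)) \<partial>lborel) = ennreal (A powr e / e)"
    by simp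
  also have "(\<integral>\<^sup>+ l. ennreal (indicator {0..A} l * l powr (e - 1)) \<partial>lborel) = (\<integral>\<^sup>+ l. ennreal (l powr (e - 1)) * indicator {l. 0 < l \<and> l < A} l \<partial>lborel)"
  proof (rule nn_integral_cong_AE)
    show "AE l in lborel. ennreal (indicator {0..A} l * l powr (e - 1)) =
        ennreal (l powr (e - 1)) * indicator {l. 0 < l \<and> l < A} l"
      using AE_lborel_singleton[of 0] AE_lborel_singleton[of A]
      by eventually_elim (auto split: split_indicator)
  qed
  finally show ?thesis by simp
qed

text \<open>Stated for a single value \<open>a\<close>, so that Fubini can be applied later with
  \<open>a\<close> a function of the point. The value \<open>top\<close> is included because a
  maximal function may be infinite.\<close>

lemma layer_cake_epow:
  assumes e: "0 < e"
  shows "(\<integral>\<^sup>+ l. ennreal (l powr (e - 1)) * indicator {l. 0 < l \<and> ennreal l < a} l \<partial>lborel)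
           = ennreal (1 / e) * epow a e" (is "?I = _")
proof (cases a)
  case (real A)
  have "{l. 0 < l \<and> ennreal l < a} = {l. 0 < l \<and> l < A}"
    using real by (auto simp: ennreal_less_iff)
  then show ?thesis
    using nn_integral_powr_Ioo[OF e, of A] real e
    by (simp add: epow_ennreal ennreal_mult[symmetric] field_simps del: ennreal_mult)
next
  case top
  have ge: "ennreal x \<le> ?I" if x: "0 \<le> x" for x
  proof -
    \<comment> \<open>Solves \<open>A powr e / e = x\<close>, so the levels below \<open>A\<close>
      alone already contribute \<open>x\<close>.\<close>
    define A where "A = (e * x) powr (1 / e)"
    have "ennreal x = ennreal (A powr e / e)"
      using x e by (simp add: A_def powr_powr)
    also have "\<dots> = (\<integral>\<^sup>+ l. ennreal (l powr (e - 1)) * indicator {l. 0 < l \<and> l < A} l \<partial>lborel)"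
      by (rule nn_integral_powr_Ioo[symmetric]) (auto simp: e A_def)
    also have "\<dots> \<le> ?I"
      by (intro nn_integral_mono) (auto simp: top split: split_indicator)
    finally show ?thesis .
  qed
  have "?I = top"
  proof (rule ccontr)
    assume "?I \<noteq> top"
    then obtain y where "0 \<le> y" "?I = ennreal y" by (cases ?I) auto
    with ge[of "y + 1"] show False by (simp add: ennreal_le_iff)
  qed
  then show ?thesis using top e by (simp add: epow_top ennreal_mult_top)
qed

section \<open>The Hardy-Littlewood maximal function\<close>

text \<open>Rational radii make the supremum visibly measurable.\<close>

definition HL :: "(real \<Rightarrow> ennreal) \<Rightarrow> real \<Rightarrow> ennreal" where
  "HL U x = (SUP h\<in>{h\<in>\<rat>. 0 < h}. ennreal (1 / h) * (\<integral>\<^sup>+ y. U y * indicator (ball x h) y \<partial>lborel))"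

lemma borel_measurable_HL [measurable]:
  assumes [measurable]: "U \<in> borel_measurable borel"
  shows "HL U \<in> borel_measurable borel"
  unfolding HL_def
proof (rule borel_measurable_SUP)
  show "countable {h \<in> \<rat>. (0::real) < h}"
    by (rule countable_subset[OF _ countable_rat]) auto
  fix h :: real
  \<comment> \<open>The ball becomes a section of an open subset of the plane; joint measurability
    of its indicator makes the integral measurable in the centre.\<close>
  have eq: "(\<lambda>x. \<integral>\<^sup>+ y. U y * indicator (ball x h) y \<partial>lborel) =
      (\<lambda>x. \<integral>\<^sup>+ y. U y * indicator {z. dist (fst z) (snd z) < h} (x, y) \<partial>lborel)"
    by (intro ext nn_integral_cong) (auto split: split_indicator)
  have "open {z::real \<times> real. dist (fst z) (snd z) < h}"
    by (intro open_Collect_less continuous_intros)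
  then have [measurable]: "{z. dist (fst z) (snd z) < h} \<in> sets (borel :: (real \<times> real) measure)"
    by simp
  then have [measurable]: "{z. dist (fst z) (snd z) < h} \<in> sets (borel \<Otimes>\<^sub>M (lborel :: real measure))"
    by (subst sets_pair_measure_cong[OF refl sets_lborel]) (simp only: borel_prod)
  have "(\<lambda>x. \<integral>\<^sup>+ y. U y * indicator (ball x h) y \<partial>lborel) \<in> borel_measurable borel"
    unfolding eq by measurable
  then show "(\<lambda>x. ennreal (1 / h) * (\<integral>\<^sup>+ y. U y * indicator (ball x h) y \<partial>lborel)) \<in> borel_measurable borel"
    by measurable
qed

text \<open>A rational radius between \<open>h\<close> and \<open>2 * h\<close> enlarges the ball
  and at most doubles the normalising factor.\<close>

lemma ball_average_le_HL:
  assumes h: "0 < h"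
  shows "ennreal (1 / h) * (\<integral>\<^sup>+ y. U y * indicator (ball x h) y \<partial>lborel) \<le> 2 * HL U x"
proof -
  obtain k where k: "k \<in> \<rat>" "h < k" "k < 2 * h"
    using Rats_dense_in_real[of h "2 * h"] h by auto
  have "ennreal (1 / h) * (\<integral>\<^sup>+ y. U y * indicator (ball x h) y \<partial>lborel)
      \<le> ennreal (2 * (1 / k)) * (\<integral>\<^sup>+ y. U y * indicator (ball x k) y \<partial>lborel)"
    using k h by (intro mult_mono nn_integral_mono ennreal_leI) (auto split: split_indicator simp: field_simps)
  also have "\<dots> = 2 * (ennreal (1 / k) * (\<integral>\<^sup>+ y. U y * indicator (ball x k) y \<partial>lborel))"
    using k h by (subst ennreal_mult) (auto simp: mult.assoc)
  also have "\<dots> \<le> 2 * HL U x"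
    unfolding HL_def using k h by (intro mult_left_mono SUP_upper) auto
  finally show ?thesis .
qed

section \<open>Weak type (1,1) bound by a Vitali covering\<close>

lemma emeasure_UN_le_nn_integral:
  assumes I: "countable I" and X [measurable]: "\<And>i. i \<in> I \<Longrightarrow> X i \<in> sets M"
  shows "emeasure M (\<Union>i\<in>I. X i) \<le> (\<integral>\<^sup>+ i. emeasure M (X i) \<partial>count_space I)"
proof -
  have [measurable]: "(\<Union>i\<in>I. X i) \<in> sets M"
    using I X by (intro sets.countable_UN') auto
  have "emeasure M (\<Union>i\<in>I. X i) = (\<integral>\<^sup>+ x. indicator (\<Union>i\<in>I. X i) x \<partial>M)"
    by simp
  also have "\<dots> \<le> (\<integral>\<^sup>+ x. \<integral>\<^sup>+ i. indicator (X i) x \<partial>count_space I \<partial>M)"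
  proof (intro nn_integral_mono)
    fix x
    show "indicator (\<Union>i\<in>I. X i) x \<le> (\<integral>\<^sup>+ i. indicator (X i) x \<partial>count_space I)"
    proof (cases "x \<in> (\<Union>i\<in>I. X i)")
      case True
      then obtain j where j: "j \<in> I" "x \<in> X j" by auto
      have "(1::ennreal) = (\<integral>\<^sup>+ i. indicator {j} i \<partial>count_space I)"
        using j by (subst nn_integral_indicator) auto
      also have "\<dots> \<le> (\<integral>\<^sup>+ i. indicator (X i) x \<partial>count_space I)"
        using j by (intro nn_integral_mono) (auto split: split_indicator)
      finally show ?thesis using True by simp
    qed simp
  qed
  also have "\<dots> = (\<integral>\<^sup>+ i. \<integral>\<^sup>+ x. indicator (X i) x \<partial>M \<partial>count_space I)"
    using I by (intro nn_integral_count_space_nn_integral) auto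
  also have "\<dots> = (\<integral>\<^sup>+ i. emeasure M (X i) \<partial>count_space I)"
    by (intro nn_integral_cong) simp
  finally show ?thesis .
qed

lemma HL_weak_type:
  assumes U [measurable]: "U \<in> borel_measurable borel" and l: "0 < l"
  shows "emeasure lborel {x. ennreal l < HL U x} \<le> ennreal (10 / l) * (\<integral>\<^sup>+ y. U y \<partial>lborel)"
proof (cases "\<integral>\<^sup>+ y. U y \<partial>lborel")
  case top
  then show ?thesis using l by (simp add: ennreal_mult_top)
next
  case (real I)
  define E where "E = {x. ennreal l < HL U x}"
  define J where "J x h = (\<integral>\<^sup>+ y. U y * indicator (ball x h) y \<partial>lborel)" for x h
  have "\<exists>h>0. ennreal l < ennreal (1 / h) * J x h" if "x \<in> E" for x
    using that unfolding E_def HL_def J_def by (auto simp: less_SUP_iff)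
  then obtain \<rho> where \<rho>: "\<And>x. x \<in> E \<Longrightarrow> 0 < \<rho> x" "\<And>x. x \<in> E \<Longrightarrow> ennreal l < ennreal (1 / \<rho> x) * J x (\<rho> x)"
    by metis
  have J: "ennreal (l * \<rho> x) \<le> J x (\<rho> x)" if "x \<in> E" for x
  proof -
    have "ennreal (l * \<rho> x) = ennreal (\<rho> x) * ennreal l"
      using \<rho>(1)[OF that] l by (simp add: ennreal_mult mult.commute)
    also have "\<dots> \<le> ennreal (\<rho> x) * (ennreal (1 / \<rho> x) * J x (\<rho> x))"
      using \<rho>(2)[OF that] by (intro mult_left_mono) auto
    also have "\<dots> = J x (\<rho> x)"
      using \<rho>(1)[OF that] by (simp add: mult.assoc[symmetric] ennreal_mult[symmetric] del: ennreal_mult)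
    finally show ?thesis .
  qed
  have J_le: "J x h \<le> ennreal I" for x h
    unfolding J_def real(2)[symmetric] by (intro nn_integral_mono) (auto split: split_indicator)
  \<comment> \<open>Finite total mass bounds the radii, as the Vitali covering lemma
    requires.\<close>
  have bnd: "0 < \<rho> x \<and> \<rho> x \<le> I / l" if "x \<in> E" for x
  proof -
    have "l * \<rho> x \<le> I"
      using order_trans[OF J[OF that] J_le] real(1) by (simp add: ennreal_le_iff)
    with l \<rho>(1)[OF that] show ?thesis by (simp add: field_simps)
  qed
  obtain C where C: "countable C" "C \<subseteq> E"
      "pairwise (\<lambda>i j. disjnt (cball i (\<rho> i)) (cball j (\<rho> j))) C"
      "\<And>i. i \<in> E \<Longrightarrow> \<exists>j. j \<in> C \<and> \<not> disjnt (cball i (\<rho> i)) (cball j (\<rho> j)) \<and>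
          cball i (\<rho> i) \<subseteq> ball j (5 * \<rho> j)"
    by (rule Vitali_covering_lemma_cballs_balls[of E \<rho> "I / l" "\<lambda>x. x"]) (erule bnd, rule that)
  have pos: "0 < \<rho> j" if "j \<in> C" for j using that C(2) \<rho>(1) by auto
  have "E \<subseteq> (\<Union>j\<in>C. ball j (5 * \<rho> j))"
  proof
    fix i assume i: "i \<in> E"
    then have "i \<in> cball i (\<rho> i)" using \<rho>(1)[OF i] by simp
    with C(4)[OF i] show "i \<in> (\<Union>j\<in>C. ball j (5 * \<rho> j))" by blast
  qed
  then have "emeasure lborel E \<le> emeasure lborel (\<Union>j\<in>C. ball j (5 * \<rho> j))"
    by (intro emeasure_mono) (auto simp: C(1))
  also have "\<dots> \<le> (\<integral>\<^sup>+ j. emeasure lborel (ball j (5 * \<rho> j)) \<partial>count_space C)"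
    using C(1) by (intro emeasure_UN_le_nn_integral) auto
  also have "\<dots> \<le> (\<integral>\<^sup>+ j. ennreal (10 / l) * J j (\<rho> j) \<partial>count_space C)"
  proof (intro nn_integral_mono)
    fix j assume "j \<in> space (count_space C)"
    then have j: "j \<in> C" by simp
    have "emeasure lborel (ball j (5 * \<rho> j)) = ennreal (10 / l) * ennreal (l * \<rho> j)"
      using pos[OF j] l by (simp add: ball_eq_greaterThanLessThan ennreal_mult[symmetric] del: ennreal_mult)
    also have "\<dots> \<le> ennreal (10 / l) * J j (\<rho> j)"
      using J C(2) j by (intro mult_left_mono) auto
    finally show "emeasure lborel (ball j (5 * \<rho> j)) \<le> ennreal (10 / l) * J j (\<rho> j)" .
  qed
  also have "\<dots> = ennreal (10 / l) * (\<integral>\<^sup>+ j. J j (\<rho> j) \<partial>count_space C)"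
    by (rule nn_integral_cmult) simp
  also have "(\<integral>\<^sup>+ j. J j (\<rho> j) \<partial>count_space C) = (\<integral>\<^sup>+ j. emeasure (density lborel U) (ball j (\<rho> j)) \<partial>count_space C)"
    by (intro nn_integral_cong) (simp add: J_def emeasure_density)
  \<comment> \<open>Disjointness pays off here: the integrals of \<open>U\<close> over the selected
    balls add up to one value of the measure with density \<open>U\<close>, at most its total mass.
    Writing the sums as integrals over the counting measure avoids enumerating
    \<open>C\<close>.\<close>
  also have "\<dots> = emeasure (density lborel U) (\<Union>j\<in>C. ball j (\<rho> j))"
  proof (rule emeasure_UN_countable[symmetric])
    show "disjoint_family_on (\<lambda>j. ball j (\<rho> j)) C"
      unfolding disjoint_family_on_def
    proof (intro ballI impI)
      fix m n assume "m \<in> C" "n \<in> C" "m \<noteq> n"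
      then have "disjnt (cball m (\<rho> m)) (cball n (\<rho> n))" using C(3) by (auto simp: pairwise_def)
      then show "ball m (\<rho> m) \<inter> ball n (\<rho> n) = {}"
        unfolding disjnt_def using ball_subset_cball[of m "\<rho> m"] ball_subset_cball[of n "\<rho> n"] by blast
    qed
  qed (auto simp: C(1))
  also have "\<dots> \<le> emeasure (density lborel U) UNIV"
    by (intro emeasure_mono) auto
  also have "\<dots> = (\<integral>\<^sup>+ y. U y \<partial>lborel)"
    by (subst emeasure_density) auto
  finally show ?thesis
    by (simp add: E_def mult_left_mono)
qed

text \<open>The part of \<open>U\<close> of height at most \<open>l / 4\<close> contributes at most
  \<open>l / 2\<close>: averages are normalised by the radius, and a ball has length twice its
  radius.\<close>

lemma HL_truncate:
  assumes U [measurable]: "U \<in> borel_measurable borel" and l: "0 < l"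
  shows "HL U x \<le> HL (\<lambda>y. U y * indicator {y. ennreal (l / 4) < U y} y) x + ennreal (l / 2)"
  unfolding HL_def
proof (rule SUP_least)
  fix h :: real assume h: "h \<in> {h \<in> \<rat>. 0 < h}"
  let ?V = "\<lambda>y. U y * indicator {y. ennreal (l / 4) < U y} y"
  have [measurable]: "ball x h \<in> sets borel" by simp
  have "(\<integral>\<^sup>+ y. U y * indicator (ball x h) y \<partial>lborel)
      \<le> (\<integral>\<^sup>+ y. ?V y * indicator (ball x h) y + ennreal (l / 4) * indicator (ball x h) y \<partial>lborel)"
    by (intro nn_integral_mono) (auto split: split_indicator)
  also have "\<dots> = (\<integral>\<^sup>+ y. ?V y * indicator (ball x h) y \<partial>lborel) + ennreal (l / 4) * emeasure lborel (ball x h)"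
    by (subst nn_integral_add) (measurable, simp add: nn_integral_cmult_indicator)
  also have "emeasure lborel (ball x h) = ennreal (2 * h)"
    using h by (simp add: ball_eq_greaterThanLessThan)
  finally have "ennreal (1 / h) * (\<integral>\<^sup>+ y. U y * indicator (ball x h) y \<partial>lborel)
      \<le> ennreal (1 / h) * ((\<integral>\<^sup>+ y. ?V y * indicator (ball x h) y \<partial>lborel) + ennreal (l / 4) * ennreal (2 * h))"
    by (rule mult_left_mono) simp
  also have "\<dots> = ennreal (1 / h) * (\<integral>\<^sup>+ y. ?V y * indicator (ball x h) y \<partial>lborel) + ennreal (l / 2)"
    using h l by (simp add: distrib_left ennreal_mult[symmetric])
  also have "\<dots> \<le> (SUP h\<in>{h\<in>\<rat>. 0 < h}. ennreal (1 / h) * (\<integral>\<^sup>+ y. ?V y * indicator (ball x h) y \<partial>lborel)) + ennreal (l / 2)"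
    using h by (intro add_right_mono SUP_upper) auto
  finally show "ennreal (1 / h) * (\<integral>\<^sup>+ y. U y * indicator (ball x h) y \<partial>lborel) \<le> \<dots>" .
qed

text \<open>The truncated function has to supply the other half of the level \<open>l\<close>, so
  the weak type bound is applied at \<open>l / 2\<close>, which doubles its constant.\<close>

lemma HL_weak_type_truncated:
  assumes U [measurable]: "U \<in> borel_measurable borel" and l: "0 < l"
  shows "emeasure lborel {x. ennreal l < HL U x}
           \<le> ennreal (20 / l) * (\<integral>\<^sup>+ y. U y * indicator {y. ennreal (l / 4) < U y} y \<partial>lborel)"
proof -
  let ?V = "\<lambda>y. U y * indicator {y. ennreal (l / 4) < U y} y"
  have "ennreal (l / 2) < HL ?V x" if "ennreal l < HL U x" for x
  proof (rule ccontr)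
    assume "\<not> ennreal (l / 2) < HL ?V x"
    then have "HL U x \<le> ennreal (l / 2) + ennreal (l / 2)"
      using HL_truncate[OF U l, of x] by (meson add_right_mono not_less order_trans)
    also have "\<dots> = ennreal l"
      using l by (simp add: ennreal_plus[symmetric] del: ennreal_plus)
    finally show False using that by simp
  qed
  then have "emeasure lborel {x. ennreal l < HL U x} \<le> emeasure lborel {x. ennreal (l / 2) < HL ?V x}"
    by (intro emeasure_mono) auto
  also have "\<dots> \<le> ennreal (10 / (l / 2)) * (\<integral>\<^sup>+ y. ?V y \<partial>lborel)"
    using l by (intro HL_weak_type) auto
  finally show ?thesis by simp
qed

text \<open>Marcinkiewicz interpolation between the weak type bound and \<open>L\<^sup>\<infinity>\<close>: in the layer cake
  formula for the maximal function, only the part of \<^term>\<open>U\<close> above height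
  \<^term>\<open>l / 4\<close> matters at level \<^term>\<open>l\<close>.\<close>

lemma HL_strong_type:
  assumes U [measurable]: "U \<in> borel_measurable borel" and r: "1 < r"
  shows "(\<integral>\<^sup>+ x. epow (HL U x) r \<partial>lborel)
           \<le> ennreal (20 * r / (r - 1) * 4 powr (r - 1)) * (\<integral>\<^sup>+ x. epow (U x) r \<partial>lborel)"
proof -
  \<comment> \<open>The integrand after the level sets have been estimated: the factor
    \<open>20 / l\<close> of the truncated weak type bound lowers the exponent of \<open>l\<close>
    by one.\<close>
  define Q where "Q l y = 20 * (ennreal (l powr (r - 1 - 1)) * U y * indicator {l. 0 < l \<and> ennreal l < 4 * U y} l)" for l y
  have [measurable]: "case_prod Q \<in> borel_measurable (lborel \<Otimes>\<^sub>M lborel)"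
    unfolding Q_def by measurable
  have layer: "epow a r = ennreal r * (\<integral>\<^sup>+ l. ennreal (l powr (r - 1)) * indicator {l. 0 < l \<and> ennreal l < a} l \<partial>lborel)" for a
    using r by (subst layer_cake_epow) (auto simp: mult.assoc[symmetric] ennreal_mult[symmetric])
  have "(\<integral>\<^sup>+ x. epow (HL U x) r \<partial>lborel)
      = ennreal r * (\<integral>\<^sup>+ x. \<integral>\<^sup>+ l. ennreal (l powr (r - 1)) * indicator {l. 0 < l \<and> ennreal l < HL U x} l \<partial>lborel \<partial>lborel)"
    unfolding layer by (rule nn_integral_cmult) simp
  also have "(\<integral>\<^sup>+ x. \<integral>\<^sup>+ l. ennreal (l powr (r - 1)) * indicator {l. 0 < l \<and> ennreal l < HL U x} l \<partial>lborel \<partial>lborel)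
     = (\<integral>\<^sup>+ l. \<integral>\<^sup>+ x. ennreal (l powr (r - 1)) * indicator {l. 0 < l \<and> ennreal l < HL U x} l \<partial>lborel \<partial>lborel)"
    by (rule lborel_pair.Fubini'[symmetric]) measurable
  also have "\<dots> \<le> (\<integral>\<^sup>+ l. \<integral>\<^sup>+ y. Q l y \<partial>lborel \<partial>lborel)"
  proof (rule nn_integral_mono)
    fix l :: real
    show "(\<integral>\<^sup>+ x. ennreal (l powr (r - 1)) * indicator {l. 0 < l \<and> ennreal l < HL U x} l \<partial>lborel)
       \<le> (\<integral>\<^sup>+ y. Q l y \<partial>lborel)"
    proof (cases "0 < l")
      case True
      have iff: "ennreal (l / 4) < a \<longleftrightarrow> ennreal l < 4 * a" for a
      proof (cases a)
        case (real b)
        then show ?thesis using True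
          by (auto simp: ennreal_less_iff ennreal_numeral[symmetric] ennreal_mult[symmetric] simp del: ennreal_numeral)
      qed (auto simp: ennreal_mult_top)
      have "(\<integral>\<^sup>+ x. ennreal (l powr (r - 1)) * indicator {l. 0 < l \<and> ennreal l < HL U x} l \<partial>lborel)
         = (\<integral>\<^sup>+ x. ennreal (l powr (r - 1)) * indicator {x. ennreal l < HL U x} x \<partial>lborel)"
        using True by (intro nn_integral_cong) (auto split: split_indicator)
      also have "\<dots> = ennreal (l powr (r - 1)) * emeasure lborel {x. ennreal l < HL U x}"
        by (rule nn_integral_cmult_indicator) measurable
      also have "\<dots> \<le> ennreal (l powr (r - 1)) * (ennreal (20 / l) * (\<integral>\<^sup>+ y. U y * indicator {y. ennreal (l / 4) < U y} y \<partial>lborel))"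
        by (intro mult_left_mono HL_weak_type_truncated U True) simp
      also have "\<dots> = ennreal (20 * l powr (r - 1 - 1)) * (\<integral>\<^sup>+ y. U y * indicator {y. ennreal (l / 4) < U y} y \<partial>lborel)"
        using True by (simp add: mult.assoc[symmetric] ennreal_mult[symmetric] powr_diff field_simps power2_eq_square)
      also have "\<dots> = (\<integral>\<^sup>+ y. ennreal (20 * l powr (r - 1 - 1)) * (U y * indicator {y. ennreal (l / 4) < U y} y) \<partial>lborel)"
        by (rule nn_integral_cmult[symmetric]) measurable
      also have "\<dots> = (\<integral>\<^sup>+ y. Q l y \<partial>lborel)"
        using True by (intro nn_integral_cong) (auto simp: Q_def ennreal_mult mult.assoc iff split: split_indicator)
      finally show ?thesis by simp
    qed simp
  qed
  also have "\<dots> = (\<integral>\<^sup>+ y. \<integral>\<^sup>+ l. Q l y \<partial>lborel \<partial>lborel)"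
    by (rule lborel_pair.Fubini') measurable
  also have "\<dots> = (\<integral>\<^sup>+ y. ennreal (20 * (1 / (r - 1)) * 4 powr (r - 1)) * epow (U y) r \<partial>lborel)"
  proof (rule nn_integral_cong)
    fix y :: real
    have "(\<integral>\<^sup>+ l. Q l y \<partial>lborel)
       = (\<integral>\<^sup>+ l. (20 * U y) * (ennreal (l powr (r - 1 - 1)) * indicator {l. 0 < l \<and> ennreal l < 4 * U y} l) \<partial>lborel)"
      by (simp add: Q_def ac_simps)
    \<comment> \<open>After the exchange of integrals, the level integral is a layer cake with
      exponent \<open>r - 1\<close>. Its convergence at 0 is where \<open>r > 1\<close> is used, and
      it yields the factor \<open>1 / (r - 1)\<close>.\<close>
    also have "\<dots> = (20 * U y) * (ennreal (1 / (r - 1)) * epow (4 * U y) (r - 1))"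
      using r by (subst nn_integral_cmult) (measurable, subst layer_cake_epow, auto)
    also have "epow (4 * U y) (r - 1) = ennreal (4 powr (r - 1)) * epow (U y) (r - 1)"
      using r epow_ennreal[of 4 "r - 1"] by (simp add: epow_mult)
    also have "(20 * U y) * (ennreal (1 / (r - 1)) * (ennreal (4 powr (r - 1)) * epow (U y) (r - 1)))
       = (ennreal 20 * ennreal (1 / (r - 1)) * ennreal (4 powr (r - 1))) * (U y * epow (U y) (r - 1))"
      by (simp add: ac_simps)
    also have "U y * epow (U y) (r - 1) = epow (U y) r"
      using r by (cases "U y") (auto simp: epow_ennreal epow_top ennreal_mult_top ennreal_mult[symmetric] powr_mult_base)
    also have "ennreal 20 * ennreal (1 / (r - 1)) * ennreal (4 powr (r - 1)) = ennreal (20 * (1 / (r - 1)) * 4 powr (r - 1))"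
      using r by (simp add: ennreal_mult[symmetric] del: ennreal_numeral)
    finally show "(\<integral>\<^sup>+ l. Q l y \<partial>lborel)
       = ennreal (20 * (1 / (r - 1)) * 4 powr (r - 1)) * epow (U y) r" .
  qed
  also have "\<dots> = ennreal (20 * (1 / (r - 1)) * 4 powr (r - 1)) * (\<integral>\<^sup>+ y. epow (U y) r \<partial>lborel)"
    by (rule nn_integral_cmult) measurable
  finally have "(\<integral>\<^sup>+ x. epow (HL U x) r \<partial>lborel)
      \<le> ennreal r * (ennreal (20 * (1 / (r - 1)) * 4 powr (r - 1)) * (\<integral>\<^sup>+ y. epow (U y) r \<partial>lborel))"
    by (simp add: mult_left_mono)
  also have "\<dots> = ennreal (20 * r / (r - 1) * 4 powr (r - 1)) * (\<integral>\<^sup>+ y. epow (U y) r \<partial>lborel)"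
    using r by (simp add: mult.assoc[symmetric] ennreal_mult[symmetric]) (simp add: field_simps)
  finally show ?thesis .
qed

section \<open>Averages along dilated curves\<close>

text \<open>Off \<open>K\<close> nothing is known about \<open>g\<close>; replacing it there by 0
  gives a Borel function, and the indicator hides the change.\<close>

lemma borel_measurable_comp_indicator:
  fixes g :: "real \<Rightarrow> real" and h :: "real \<Rightarrow> ennreal"
  assumes K: "closed K" and g: "continuous_on K g" and h [measurable]: "h \<in> borel_measurable borel"
  shows "(\<lambda>s. h (g s) * indicator K s) \<in> borel_measurable borel"
proof -
  have [measurable]: "K \<in> sets borel" using K by simp
  have [measurable]: "(\<lambda>s. if s \<in> K then g s else 0) \<in> borel_measurable borel"
    by (intro borel_measurable_continuous_on_if g) auto
  have "(\<lambda>s. h (g s) * indicator K s) = (\<lambda>s. h (if s \<in> K then g s else 0) * indicator K s)"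
    by (auto split: split_indicator)
  also have "\<dots> \<in> borel_measurable borel" by measurable
  finally show ?thesis .
qed

text \<open>Since \<open>c \<le> g'\<close>, multiplying by \<open>c\<close> costs no more than
  inserting the Jacobian; the substitution gives an integral over \<open>{g a..g b}\<close>, which
  is then enlarged to the line.\<close>

lemma nn_integral_comp_le_increasing:
  fixes g :: "real \<Rightarrow> real" and h :: "real \<Rightarrow> ennreal"
  assumes h [measurable]: "h \<in> borel_measurable borel"
    and deriv: "\<And>x. x \<in> {a..b} \<Longrightarrow> (g has_real_derivative g' x) (at x)"
    and cont: "continuous_on {a..b} g'"
    and c: "0 < c" "\<And>x. x \<in> {a..b} \<Longrightarrow> c \<le> g' x" and ab: "a < b"
  shows "(\<integral>\<^sup>+ s. h (g s) * indicator {a..b} s \<partial>lborel) \<le> ennreal (1 / c) * (\<integral>\<^sup>+ u. h u \<partial>lborel)"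
proof -
  have cg: "continuous_on {a..b} g"
    using deriv by (rule has_real_derivative_imp_continuous_on)
  have "(\<integral>\<^sup>+ s. h (g s) * indicator {a..b} s \<partial>lborel)
      = ennreal (1 / c) * (ennreal c * (\<integral>\<^sup>+ s. h (g s) * indicator {a..b} s \<partial>lborel))"
    using c(1) by (simp add: mult.assoc[symmetric] ennreal_mult[symmetric])
  also have "ennreal c * (\<integral>\<^sup>+ s. h (g s) * indicator {a..b} s \<partial>lborel)
      = (\<integral>\<^sup>+ s. ennreal c * (h (g s) * indicator {a..b} s) \<partial>lborel)"
    using borel_measurable_comp_indicator[OF _ cg h] by (intro nn_integral_cmult[symmetric]) simp
  also have "\<dots> \<le> (\<integral>\<^sup>+ s. h (g s) * ennreal (g' s) * indicator {a..b} s \<partial>lborel)"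
  proof (rule nn_integral_mono)
    fix s :: real
    show "ennreal c * (h (g s) * indicator {a..b} s) \<le> h (g s) * ennreal (g' s) * indicator {a..b} s"
      using c(2)[of s] by (auto simp: mult.commute[of "ennreal c"] intro!: mult_left_mono ennreal_leI split: split_indicator)
  qed
  also have "\<dots> = (\<integral>\<^sup>+ u. h u * indicator {g a..g b} u \<partial>lborel)"
    by (rule nn_integral_substitution_aux[symmetric])
       (use assms c in \<open>auto intro: less_imp_le order_trans[OF less_imp_le[OF c(1)]]\<close>)
  also have "\<dots> \<le> (\<integral>\<^sup>+ u. h u \<partial>lborel)"
    by (intro nn_integral_mono) (auto split: split_indicator)
  finally show ?thesis by (simp add: mult_left_mono)
qed

text \<open>\<open>g\<close> need not be monotone on \<open>K\<close>, so the substitution is local: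
  near each point \<open>g'\<close> keeps its sign and half its size, and finitely many such
  intervals cover the compact set, their constants adding up.\<close>

lemma nn_integral_comp_le:
  fixes g g' :: "real \<Rightarrow> real"
  assumes S: "open S" and K: "compact K" "K \<subseteq> S"
    and deriv: "\<And>x. x \<in> S \<Longrightarrow> (g has_real_derivative g' x) (at x)"
    and cont: "continuous_on S g'" and nz: "\<And>x. x \<in> K \<Longrightarrow> g' x \<noteq> 0"
  shows "\<exists>C::real. 0 \<le> C \<and> (\<forall>h\<in>borel_measurable borel.
      (\<integral>\<^sup>+ s. h (g s) * indicator K s \<partial>lborel) \<le> ennreal C * (\<integral>\<^sup>+ u. h u \<partial>lborel))"
proof -
  define P where "P x e C \<longleftrightarrow> 0 < e \<and> {x - e..x + e} \<subseteq> S \<and> 0 \<le> C \<and> (\<forall>h\<in>borel_measurable borel.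
      (\<integral>\<^sup>+ s. h (g s) * indicator {x - e..x + e} s \<partial>lborel) \<le> ennreal C * (\<integral>\<^sup>+ u. h u \<partial>lborel))"
    for x e C :: real
  have "\<exists>e C. P x e C"
    if x: "x \<in> K" for x
  proof -
    \<comment> \<open>Staying within \<open>c\<close> of \<open>g' x\<close> preserves the sign of
      \<open>g'\<close> and leaves its absolute value at least \<open>c\<close>.\<close>
    define c where "c = \<bar>g' x\<bar> / 2"
    have c: "0 < c" using nz[OF x] by (simp add: c_def)
    have "isCont g' x" using cont S K x continuous_on_eq_continuous_at by blast
    then obtain d where d: "0 < d" "\<And>y. dist y x < d \<Longrightarrow> dist (g' y) (g' x) < c"
      using c unfolding continuous_at_eps_delta by blast
    obtain d' where d': "0 < d'" "ball x d' \<subseteq> S" using S K x by (meson openE subsetD)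
    define e where "e = min d d' / 2"
    have e: "0 < e" "e < d" "e < d'" using d d' by (auto simp: e_def min_def)
    have sub: "{x - e..x + e} \<subseteq> S"
      using d'(2) e by (force simp: dist_real_def)
    have near: "\<bar>g' y - g' x\<bar> < c" if "y \<in> {x - e..x + e}" for y
      using d(2)[of y] that e by (auto simp: dist_real_def)
    have cont': "continuous_on {x - e..x + e} g'" using cont sub continuous_on_subset by blast
    have "(\<integral>\<^sup>+ s. h (g s) * indicator {x - e..x + e} s \<partial>lborel) \<le> ennreal (1 / c) * (\<integral>\<^sup>+ u. h u \<partial>lborel)"
      if h [measurable]: "h \<in> borel_measurable borel" for h :: "real \<Rightarrow> ennreal"
    proof (cases "0 < g' x")
      case True
      show ?thesis
      proof (rule nn_integral_comp_le_increasing[OF h _ cont' c])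
        fix y assume y: "y \<in> {x - e..x + e}"
        then show "(g has_real_derivative g' y) (at y)" using deriv sub by blast
        show "c \<le> g' y" using near[OF y] True by (auto simp: c_def abs_if split: if_splits)
      qed (use e in auto)
    next
      \<comment> \<open>A decreasing \<open>g\<close> is reflected together with \<open>h\<close>;
        the integral of \<open>h\<close> over the line does not change.\<close>
      case False
      have "(\<integral>\<^sup>+ s. h (- (- g s)) * indicator {x - e..x + e} s \<partial>lborel)
          \<le> ennreal (1 / c) * (\<integral>\<^sup>+ u. h (- u) \<partial>lborel)"
      proof (rule nn_integral_comp_le_increasing[where h = "\<lambda>u. h (- u)" and g = "\<lambda>s. - g s" and g' = "\<lambda>s. - g' s"])
        fix y assume y: "y \<in> {x - e..x + e}"
        then show "((\<lambda>s. - g s) has_real_derivative - g' y) (at y)"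
          using deriv sub by (intro DERIV_minus) blast
        show "c \<le> - g' y" using near[OF y] False nz[OF x] by (auto simp: c_def abs_if split: if_splits)
      next
        show "continuous_on {x - e..x + e} (\<lambda>s. - g' s)" by (intro continuous_on_minus cont')
      qed (use e c in auto)
      also have "(\<integral>\<^sup>+ u. h (- u) \<partial>lborel) = (\<integral>\<^sup>+ u. h u \<partial>lborel)"
        using nn_integral_real_affine[of h "-1" 0] by simp
      finally show ?thesis by simp
    qed
    then show ?thesis using e sub c by (intro exI[of _ e] exI[of _ "1 / c"]) (auto simp: P_def)
  qed
  then obtain e C where P: "\<And>x. x \<in> K \<Longrightarrow> P x (e x) (C x)"
    by metis
  have e: "\<And>x. x \<in> K \<Longrightarrow> 0 < e x" "\<And>x. x \<in> K \<Longrightarrow> {x - e x..x + e x} \<subseteq> S"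
      and C0: "\<And>x. x \<in> K \<Longrightarrow> (0::real) \<le> C x"
      and C: "\<And>x h. x \<in> K \<Longrightarrow> h \<in> borel_measurable borel \<Longrightarrow>
        (\<integral>\<^sup>+ s. h (g s) * indicator {x - e x..x + e x} s \<partial>lborel) \<le> ennreal (C x) * (\<integral>\<^sup>+ u. h u \<partial>lborel)"
    using P by (auto simp: P_def)
  have "K \<subseteq> (\<Union>x\<in>K. ball x (e x))" using e(1) by force
  then obtain D where D: "D \<subseteq> K" "finite D" "K \<subseteq> (\<Union>x\<in>D. ball x (e x))"
    using compactE_image[OF K(1), of K "\<lambda>x. ball x (e x)"] by (metis open_ball)
  have "(\<integral>\<^sup>+ s. h (g s) * indicator K s \<partial>lborel) \<le> ennreal (\<Sum>x\<in>D. C x) * (\<integral>\<^sup>+ u. h u \<partial>lborel)"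
    if h: "h \<in> borel_measurable borel" for h
  proof -
    have meas: "(\<lambda>s. h (g s) * indicator {x - e x..x + e x} s) \<in> borel_measurable borel" if "x \<in> D" for x
    proof (rule borel_measurable_comp_indicator[OF _ _ h])
      show "continuous_on {x - e x..x + e x} g"
        by (rule has_real_derivative_imp_continuous_on) (use deriv e(2) D(1) that in blast)
    qed simp
    have "(\<integral>\<^sup>+ s. h (g s) * indicator K s \<partial>lborel)
        \<le> (\<integral>\<^sup>+ s. (\<Sum>x\<in>D. h (g s) * indicator {x - e x..x + e x} s) \<partial>lborel)"
    proof (rule nn_integral_mono)
      fix s
      show "h (g s) * indicator K s \<le> (\<Sum>x\<in>D. h (g s) * indicator {x - e x..x + e x} s)"
      proof (cases "s \<in> K")
        case True
        then obtain x where x: "x \<in> D" "s \<in> ball x (e x)" using D(3) by auto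
        then have "h (g s) * indicator K s \<le> h (g s) * indicator {x - e x..x + e x} s"
          using True by (auto simp: dist_real_def split: split_indicator)
        also have "\<dots> \<le> (\<Sum>x\<in>D. h (g s) * indicator {x - e x..x + e x} s)"
          using D x by (intro member_le_sum) auto
        finally show ?thesis .
      qed simp
    qed
    also have "\<dots> = (\<Sum>x\<in>D. \<integral>\<^sup>+ s. h (g s) * indicator {x - e x..x + e x} s \<partial>lborel)"
      using meas by (intro nn_integral_sum) simp
    also have "\<dots> \<le> (\<Sum>x\<in>D. ennreal (C x) * (\<integral>\<^sup>+ u. h u \<partial>lborel))"
      using D h C by (intro sum_mono) blast
    also have "\<dots> = ennreal (\<Sum>x\<in>D. C x) * (\<integral>\<^sup>+ u. h u \<partial>lborel)"
      using D C0 by (subst sum_ennreal[symmetric]) (auto simp: sum_distrib_right)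
    finally show ?thesis .
  qed
  moreover have "0 \<le> (\<Sum>x\<in>D. C x)" using C0 D by (intro sum_nonneg) auto
  ultimately show ?thesis by blast
qed

text \<open>Only values of \<open>U\<close> in the ball of radius \<open>R * t\<close> are seen, so
  \<open>U\<close> is cut off to it before the pullback enlarges the integral to the line. Rescaling
  produces \<open>1 / t\<close>, which is \<open>R\<close> times the normalisation of that ball,
  hence the uniformity in \<open>t\<close>. The factor 2 comes from
  \<open>ball_average_le_HL\<close>.\<close>

lemma dilated_average_le_HL:
  fixes g :: "real \<Rightarrow> real"
  assumes C: "0 \<le> C" and pull: "\<And>h. h \<in> borel_measurable borel \<Longrightarrow>
      (\<integral>\<^sup>+ s. h (g s) * indicator K s \<partial>lborel) \<le> ennreal C * (\<integral>\<^sup>+ u. h u \<partial>lborel)"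
    and R: "0 < R" "\<And>s. s \<in> K \<Longrightarrow> \<bar>g s\<bar> < R"
    and U [measurable]: "U \<in> borel_measurable borel" and t: "0 < t"
  shows "(\<integral>\<^sup>+ s. U (x - t * g s) * indicator K s \<partial>lborel) \<le> ennreal (2 * C * R) * HL U x"
proof -
  define V where "V y = U y * indicator (ball x (R * t)) y" for y
  have [measurable]: "ball x (R * t) \<in> sets borel" by simp
  have V [measurable]: "V \<in> borel_measurable borel" unfolding V_def by measurable
  have "(\<integral>\<^sup>+ s. U (x - t * g s) * indicator K s \<partial>lborel) = (\<integral>\<^sup>+ s. V (x - t * g s) * indicator K s \<partial>lborel)"
  proof (intro nn_integral_cong)
    fix s
    have "t * \<bar>g s\<bar> < t * R" if "s \<in> K" using R(2)[OF that] t by simp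
    then show "U (x - t * g s) * indicator K s = V (x - t * g s) * indicator K s"
      using t by (auto simp: V_def dist_real_def abs_mult mult.commute split: split_indicator)
  qed
  also have "\<dots> \<le> ennreal C * (\<integral>\<^sup>+ u. V (x - t * u) \<partial>lborel)"
    by (rule pull) measurable
  also have "(\<integral>\<^sup>+ u. V (x - t * u) \<partial>lborel) = ennreal (R * (1 / (R * t)) * t) * (\<integral>\<^sup>+ u. V (x + - t * u) \<partial>lborel)"
    using R t by simp
  also have "\<dots> = ennreal R * (ennreal (1 / (R * t)) * (ennreal \<bar>- t\<bar> * (\<integral>\<^sup>+ u. V (x + - t * u) \<partial>lborel)))"
    using R t by (subst ennreal_mult, simp, simp)+ (simp add: mult.assoc)
  also have "ennreal \<bar>- t\<bar> * (\<integral>\<^sup>+ u. V (x + - t * u) \<partial>lborel) = (\<integral>\<^sup>+ u. V u \<partial>lborel)"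
    using t by (intro nn_integral_real_affine[symmetric]) auto
  also have "ennreal (1 / (R * t)) * (\<integral>\<^sup>+ u. V u \<partial>lborel) \<le> 2 * HL U x"
    unfolding V_def using R t by (intro ball_average_le_HL) simp
  finally have "(\<integral>\<^sup>+ s. U (x - t * g s) * indicator K s \<partial>lborel) \<le> ennreal C * (ennreal R * (2 * HL U x))"
    by (simp add: mult_left_mono)
  also have "\<dots> = ennreal (2 * C * R) * HL U x"
    using C R by (simp add: ennreal_mult ac_simps)
  finally show ?thesis .
qed

text \<open>Norm bounds on f and g hold only off null sets, while the operator samples them along a
  curve. Pulling back the indicator of \<open>N\<close> shows that, for every \<open>x\<close> and
  \<open>t\<close>, almost no parameter lands in it.\<close>

lemma AE_dilated_notin_null_set:
  fixes g :: "real \<Rightarrow> real"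
  assumes pull: "\<And>h. h \<in> borel_measurable borel \<Longrightarrow>
      (\<integral>\<^sup>+ s. h (g s) * indicator K s \<partial>lborel) \<le> ennreal C * (\<integral>\<^sup>+ u. h u \<partial>lborel)"
    and K: "closed K" "continuous_on K g"
    and N: "N \<in> null_sets lborel" and t: "0 < t"
  shows "AE s in lborel. s \<in> K \<longrightarrow> x - t * g s \<notin> N"
proof -
  have [measurable]: "N \<in> sets borel" using N by auto
  let ?h = "\<lambda>u. indicator N (x - t * u) :: ennreal"
  have h: "?h \<in> borel_measurable borel" by measurable
  have "ennreal t * (\<integral>\<^sup>+ u. ?h u \<partial>lborel) = (\<integral>\<^sup>+ u. indicator N u \<partial>lborel)"
    using nn_integral_real_affine[of "indicator N" "- t" x] t by simp
  also have "\<dots> = 0" using N by auto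
  finally have "(\<integral>\<^sup>+ u. ?h u \<partial>lborel) = 0" using t by simp
  then have "(\<integral>\<^sup>+ s. ?h (g s) * indicator K s \<partial>lborel) = 0"
    using pull[OF h] by simp
  then have "AE s in lborel. ?h (g s) * indicator K s = 0"
    using borel_measurable_comp_indicator[OF K h] by (subst (asm) nn_integral_0_iff_AE) auto
  then show ?thesis by eventually_elim (auto split: split_indicator_asm)
qed

text \<open>A non-integrable \<open>F\<close> has Bochner integral 0, so the bound survives in that
  case too.\<close>

lemma ennreal_norm_integral_le:
  fixes F :: "'a \<Rightarrow> complex"
  shows "ennreal (norm (LINT s|M. F s)) \<le> (\<integral>\<^sup>+ s. ennreal (norm (F s)) \<partial>M)"
  by (cases "integrable M F") (auto simp: integral_norm_bound_ennreal not_integrable_integral_eq)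

section \<open>Maximal bounds along smooth curves\<close>

lemma smooth_on_has_real_derivative:
  "smooth_on S f \<Longrightarrow> x \<in> S \<Longrightarrow> (f has_real_derivative deriv f x) (at x)"
  unfolding smooth_on_def by (metis DERIV_deriv_iff_real_differentiable funpow_0)

lemma smooth_on_continuous_on_deriv:
  assumes "smooth_on S f" shows "continuous_on S (deriv f)"
proof (rule differentiable_imp_continuous_on)
  have "((deriv ^^ 1) f) differentiable (at x)" if "x \<in> S" for x
    using assms that unfolding smooth_on_def by blast
  then show "deriv f differentiable_on S"
    by (auto simp: differentiable_on_def intro: differentiable_at_withinI)
qed

lemma smooth_on_continuous_on:
  assumes "smooth_on S f" shows "continuous_on S f"
  by (rule has_real_derivative_imp_continuous_on[OF smooth_on_has_real_derivative[OF assms]])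

lemma dilated_average_bounds:
  fixes g :: "real \<Rightarrow> real"
  assumes g: "smooth_on S g" and S: "open S" and K: "compact K" "K \<subseteq> S"
    and nz: "\<forall>s\<in>K. deriv g s \<noteq> 0"
  obtains C where "0 \<le> C"
    "\<And>U x t. U \<in> borel_measurable borel \<Longrightarrow> 0 < t \<Longrightarrow>
       (\<integral>\<^sup>+ s. U (x - t * g s) * indicator K s \<partial>lborel) \<le> ennreal C * HL U x"
    "\<And>N x t. N \<in> null_sets lborel \<Longrightarrow> 0 < t \<Longrightarrow> AE s in lborel. s \<in> K \<longrightarrow> x - t * g s \<notin> N"
proof -
  have "\<exists>C::real. 0 \<le> C \<and> (\<forall>h\<in>borel_measurable borel.
      (\<integral>\<^sup>+ s. h (g s) * indicator K s \<partial>lborel) \<le> ennreal C * (\<integral>\<^sup>+ u. h u \<partial>lborel))"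
    by (rule nn_integral_comp_le[OF S K smooth_on_has_real_derivative[OF g] smooth_on_continuous_on_deriv[OF g]])
       (use nz in auto)
  then obtain C where C: "0 \<le> C" "\<And>h. h \<in> borel_measurable borel \<Longrightarrow>
      (\<integral>\<^sup>+ s. h (g s) * indicator K s \<partial>lborel) \<le> ennreal C * (\<integral>\<^sup>+ u. h u \<partial>lborel)"
    by blast
  have cont: "continuous_on K g"
    using smooth_on_continuous_on[OF g] K(2) by (rule continuous_on_subset)
  obtain R0 where R0: "\<And>s. s \<in> K \<Longrightarrow> \<bar>g s\<bar> \<le> R0"
    using compact_imp_bounded[OF compact_continuous_image[OF cont K(1)]] by (auto simp: bounded_iff)
  \<comment> \<open>The padding makes \<open>R\<close> positive and the bound strict, to fit the
    open ball.\<close>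
  define R where "R = max R0 0 + 1"
  have R: "0 < R" "\<And>s. s \<in> K \<Longrightarrow> \<bar>g s\<bar> < R" using R0 by (force simp: R_def)+
  show thesis
  proof (rule that[of "2 * C * R"])
    show "0 \<le> 2 * C * R" using C R by simp
    show "(\<integral>\<^sup>+ s. U (x - t * g s) * indicator K s \<partial>lborel) \<le> ennreal (2 * C * R) * HL U x"
      if "U \<in> borel_measurable borel" "0 < t" for U x t
      using dilated_average_le_HL[OF C R that] .
    show "AE s in lborel. s \<in> K \<longrightarrow> x - t * g s \<notin> N" if "N \<in> null_sets lborel" "0 < t" for N x t
      using AE_dilated_notin_null_set[OF C(2) compact_imp_closed[OF K(1)] cont that] .
  qed
qed

text \<open>Splitting the product \<open>|f||g|\<close> additively (by Young's inequality) reduces the bilinear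
  operator to two linear maximal functions.\<close>

lemma Mgamma_le_HL:
  assumes smooth: "smooth_on {0<..<1} \<gamma>1" "smooth_on {0<..<1} \<gamma>2"
    and psi: "continuous_on UNIV \<psi>" "\<forall>s. 0 \<le> \<psi> s"
    and supp: "compact (supp \<psi>)" "supp \<psi> \<subseteq> {0<..<1}"
    and nondeg: "\<forall>s\<in>supp \<psi>. deriv \<gamma>1 s \<noteq> 0 \<and> deriv \<gamma>2 s \<noteq> 0"
  obtains C where "0 \<le> C"
    "\<And>f g U V D N1 N2 x. U \<in> borel_measurable borel \<Longrightarrow> V \<in> borel_measurable borel \<Longrightarrow>
       N1 \<in> null_sets lborel \<Longrightarrow> N2 \<in> null_sets lborel \<Longrightarrow>
       (\<And>y z. y \<notin> N1 \<Longrightarrow> z \<notin> N2 \<Longrightarrow> ennreal (norm (f y)) * ennreal (norm (g z)) \<le> D * (U y + V z)) \<Longrightarrow>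
       Mgamma \<gamma>1 \<gamma>2 \<psi> f g x \<le> ennreal C * (D * (HL U x + HL V x))"
proof -
  let ?K = "supp \<psi>"
  obtain C1 where C1: "0 \<le> C1"
    "\<And>U x t. U \<in> borel_measurable borel \<Longrightarrow> 0 < t \<Longrightarrow>
       (\<integral>\<^sup>+ s. U (x - t * \<gamma>1 s) * indicator ?K s \<partial>lborel) \<le> ennreal C1 * HL U x"
    "\<And>N x t. N \<in> null_sets lborel \<Longrightarrow> 0 < t \<Longrightarrow> AE s in lborel. s \<in> ?K \<longrightarrow> x - t * \<gamma>1 s \<notin> N"
    by (rule dilated_average_bounds[OF smooth(1) open_greaterThanLessThan supp]) (use nondeg in blast, rule that)
  obtain C2 where C2: "0 \<le> C2"
    "\<And>U x t. U \<in> borel_measurable borel \<Longrightarrow> 0 < t \<Longrightarrow>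
       (\<integral>\<^sup>+ s. U (x - t * \<gamma>2 s) * indicator ?K s \<partial>lborel) \<le> ennreal C2 * HL U x"
    "\<And>N x t. N \<in> null_sets lborel \<Longrightarrow> 0 < t \<Longrightarrow> AE s in lborel. s \<in> ?K \<longrightarrow> x - t * \<gamma>2 s \<notin> N"
    by (rule dilated_average_bounds[OF smooth(2) open_greaterThanLessThan supp]) (use nondeg in blast, rule that)
  obtain B0 where B0: "\<And>s. s \<in> ?K \<Longrightarrow> \<bar>\<psi> s\<bar> \<le> B0"
    using compact_imp_bounded[OF compact_continuous_image[OF continuous_on_subset[OF psi(1)] supp(1)]]
    by (auto simp: bounded_iff)
  define B where "B = max B0 0"
  have B: "0 \<le> B" "\<And>s. s \<in> ?K \<Longrightarrow> \<psi> s \<le> B" using B0 by (force simp: B_def)+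
  have psi0: "\<psi> s = 0" if "s \<notin> ?K" for s
    using that closure_subset[of "{x. \<psi> x \<noteq> 0}"] by (auto simp: supp_def)
  have cont: "continuous_on ?K \<gamma>1" "continuous_on ?K \<gamma>2"
    using smooth[THEN smooth_on_continuous_on] supp(2) by (auto intro: continuous_on_subset)
  have cl: "closed ?K" using supp(1) by (rule compact_imp_closed)
  show thesis
  proof (rule that[of "B * (C1 + C2)"])
    show "0 \<le> B * (C1 + C2)" using B C1 C2 by simp
    fix f g :: "real \<Rightarrow> complex" and U V :: "real \<Rightarrow> ennreal" and D N1 N2 and x :: real
    \<comment> \<open>In the assumption on \<open>f\<close> and \<open>g\<close>, \<open>y\<close>
      and \<open>z\<close> vary independently because the two dilations do.\<close>
    assume U [measurable]: "U \<in> borel_measurable borel" and V [measurable]: "V \<in> borel_measurable borel"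
      and N: "N1 \<in> null_sets lborel" "N2 \<in> null_sets lborel"
      and le: "\<And>y z. y \<notin> N1 \<Longrightarrow> z \<notin> N2 \<Longrightarrow> ennreal (norm (f y)) * ennreal (norm (g z)) \<le> D * (U y + V z)"
    show "Mgamma \<gamma>1 \<gamma>2 \<psi> f g x \<le> ennreal (B * (C1 + C2)) * (D * (HL U x + HL V x))"
      unfolding Mgamma_def
    proof (rule SUP_least)
      fix t :: "real \<times> real" assume "t \<in> {0<..} \<times> {0<..}"
      then have t: "0 < fst t" "0 < snd t" by auto
      let ?u = "\<lambda>s. U (x - fst t * \<gamma>1 s) * indicator ?K s" and ?v = "\<lambda>s. V (x - snd t * \<gamma>2 s) * indicator ?K s"
      have [measurable]: "?u \<in> borel_measurable borel"
        by (rule borel_measurable_comp_indicator[OF cl cont(1), of "\<lambda>y. U (x - fst t * y)"]) measurable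
      have [measurable]: "?v \<in> borel_measurable borel"
        by (rule borel_measurable_comp_indicator[OF cl cont(2), of "\<lambda>y. V (x - snd t * y)"]) measurable
      have "ennreal (norm (LINT s|lborel. f (x - fst t * \<gamma>1 s) * g (x - snd t * \<gamma>2 s) * complex_of_real (\<psi> s)))
          \<le> (\<integral>\<^sup>+ s. ennreal (norm (f (x - fst t * \<gamma>1 s) * g (x - snd t * \<gamma>2 s) * complex_of_real (\<psi> s))) \<partial>lborel)"
        by (rule ennreal_norm_integral_le)
      also have "\<dots> \<le> (\<integral>\<^sup>+ s. (ennreal B * D) * (?u s + ?v s) \<partial>lborel)"
      proof (rule nn_integral_mono_AE)
        \<comment> \<open>The exceptional parameters may depend on \<open>x\<close> and
          \<open>t\<close>: the supremum over \<open>t\<close> is taken only after the integration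
          in \<open>s\<close>.\<close>
        show "AE s in lborel. ennreal (norm (f (x - fst t * \<gamma>1 s) * g (x - snd t * \<gamma>2 s) * complex_of_real (\<psi> s)))
            \<le> (ennreal B * D) * (?u s + ?v s)"
          using C1(3)[OF N(1) t(1), of x] C2(3)[OF N(2) t(2), of x]
        proof eventually_elim
          case (elim s)
          show ?case
          proof (cases "s \<in> ?K")
            case True
            have "ennreal (norm (f (x - fst t * \<gamma>1 s) * g (x - snd t * \<gamma>2 s) * complex_of_real (\<psi> s)))
                = ennreal (\<psi> s) * (ennreal (norm (f (x - fst t * \<gamma>1 s))) * ennreal (norm (g (x - snd t * \<gamma>2 s))))"
              using psi(2) by (simp add: norm_mult ennreal_mult ac_simps)
            also have "\<dots> \<le> ennreal B * (D * (U (x - fst t * \<gamma>1 s) + V (x - snd t * \<gamma>2 s)))"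
              using B(2)[OF True] elim True by (intro mult_mono ennreal_leI le) auto
            finally show ?thesis using True by (simp add: mult.assoc)
          qed (simp add: psi0)
        qed
      qed
      also have "\<dots> = (ennreal B * D) * ((\<integral>\<^sup>+ s. ?u s \<partial>lborel) + (\<integral>\<^sup>+ s. ?v s \<partial>lborel))"
        by (simp add: nn_integral_cmult nn_integral_add)
      also have "\<dots> \<le> (ennreal B * D) * (ennreal (C1 + C2) * HL U x + ennreal (C1 + C2) * HL V x)"
        using C1(1,2) C2(1,2) t
        by (intro mult_left_mono add_mono order_trans[OF C1(2)] order_trans[OF C2(2)] mult_right_mono ennreal_leI) auto
      also have "\<dots> = ennreal (B * (C1 + C2)) * (D * (HL U x + HL V x))"
        unfolding ennreal_mult[OF B(1) add_nonneg_nonneg[OF C1(1) C2(1)]]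
        by (simp only: distrib_left[where 'a = ennreal] ac_simps)
      finally show "ennreal (norm (LINT s|lborel. f (x - fst t * \<gamma>1 s) * g (x - snd t * \<gamma>2 s) * complex_of_real (\<psi> s)))
          \<le> ennreal (B * (C1 + C2)) * (D * (HL U x + HL V x))" .
    qed
  qed
qed

section \<open>The upper bound for exponents above one\<close>

lemma Lpn_ennreal: "0 < P \<Longrightarrow> Lpn (ennreal P) h = epow (\<integral>\<^sup>+ x. epow (h x) P \<partial>lborel) (1 / P)"
  by (simp add: Lpn_def)

lemma Lpn_top_le: "(\<And>x. h x \<le> c) \<Longrightarrow> Lpn top h \<le> c"
  by (simp add: Lpn_def Inf_lower)

text \<open>The infimum of the essential bounds is the infimum of a sequence of them, and countably
  many exceptional null sets may be united.\<close>

lemma AE_le_Lpn_top: "AE x in lborel. h x \<le> Lpn top h"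
proof -
  obtain f :: "nat \<Rightarrow> ennreal" where f: "range f \<subseteq> {c. AE x in lborel. h x \<le> c}"
      "Inf {c. AE x in lborel. h x \<le> c} = (INF i. f i)"
    using ennreal_Inf_countable_INF[of "{c. AE x in lborel. h x \<le> c}"] top_greatest by blast
  have "AE x in lborel. \<forall>i. h x \<le> f i"
    using f(1) by (auto simp: AE_all_countable)
  then show ?thesis
    unfolding Lpn_def f(2) by (auto intro: INF_greatest)
qed

text \<open>One normal form for all exponents. The null set absorbs what exact division misses: for
  \<open>p = top\<close> the bound holds only almost everywhere, and a function of norm 0 vanishes
  only almost everywhere, in which case \<open>W\<close> is 0.\<close>

lemma Lpn_normalise:
  assumes h [measurable]: "h \<in> borel_measurable borel" and p: "0 < p" and fin: "Lpn p h < top"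
  obtains W N where "W \<in> borel_measurable borel" "N \<in> null_sets lborel"
    "\<And>y. y \<notin> N \<Longrightarrow> h y \<le> Lpn p h * W y"
    "p \<noteq> top \<Longrightarrow> (\<integral>\<^sup>+ y. epow (W y) (enn2real p) \<partial>lborel) \<le> 1"
    "p = top \<Longrightarrow> W = (\<lambda>_. 1)"
proof (cases p)
  case top
  define N where "N = {y. \<not> h y \<le> Lpn p h}"
  have "N \<in> null_sets lborel"
    using AE_le_Lpn_top[of h] unfolding top N_def by (subst AE_iff_null_sets) auto
  then show thesis
    using top by (intro that[of "\<lambda>_. 1" N]) (auto simp: N_def)
next
  case (real P)
  then have P: "0 < P" using p by simp
  define I where "I = (\<integral>\<^sup>+ x. epow (h x) P \<partial>lborel)"
  have A: "Lpn p h = epow I (1 / P)" using P by (simp add: real Lpn_ennreal I_def)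
  with fin have "I \<noteq> top" by (auto simp: epow_top)
  then obtain i where i: "0 \<le> i" "I = ennreal i" by (cases I) auto
  show thesis
  proof (cases "i = 0")
    case True
    then have "(\<integral>\<^sup>+ x. epow (h x) P \<partial>lborel) = 0"
      using i by (simp add: I_def)
    then have "AE x in lborel. h x = 0"
      by (subst (asm) nn_integral_0_iff_AE) auto
    then have "{y. h y \<noteq> 0} \<in> null_sets lborel" by (subst AE_iff_null_sets) auto
    then show thesis
      using real by (intro that[of "\<lambda>_. 0" "{y. h y \<noteq> 0}"]) auto
  next
    case False
    with i have i: "0 < i" "I = ennreal i" by auto
    define a where "a = i powr (1 / P)"
    have a: "0 < a" "Lpn p h = ennreal a" using i by (auto simp: a_def A epow_ennreal)
    have "(\<integral>\<^sup>+ y. epow (ennreal (1 / a) * h y) P \<partial>lborel) = (\<integral>\<^sup>+ y. ennreal ((1 / a) powr P) * epow (h y) P \<partial>lborel)"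
      using P a by (simp add: epow_mult epow_ennreal)
    also have "\<dots> = ennreal ((1 / a) powr P) * I"
      unfolding I_def by (rule nn_integral_cmult) measurable
    also have "\<dots> = 1"
      using i a P by (simp add: ennreal_mult[symmetric] powr_divide a_def powr_powr)
    finally have "(\<integral>\<^sup>+ y. epow (ennreal (1 / a) * h y) P \<partial>lborel) = 1" .
    moreover have "h y = ennreal a * (ennreal (1 / a) * h y)" for y
      using a by (simp add: mult.assoc[symmetric] ennreal_mult[symmetric])
    ultimately show thesis
      using real P a by (intro that[of "\<lambda>y. ennreal (1 / a) * h y" "{}"]) auto
  qed
qed

lemma Youngs_inequality_ennreal:
  assumes "1 < a" "1 < b" "1 / a + 1 / b = 1"
  shows "X * Y \<le> epow X a + epow Y b"
proof (cases X; cases Y)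
  fix x y assume xy: "0 \<le> x" "X = ennreal x" "0 \<le> y" "Y = ennreal y"
  have "x * y \<le> x powr a / a + y powr b / b"
    using assms xy by (intro Youngs_inequality) auto
  also have "\<dots> \<le> x powr a + y powr b"
    using assms by (intro add_mono) (auto simp: divide_le_eq mult_le_cancel_left1)
  finally show ?thesis
    using xy by (simp add: epow_ennreal ennreal_mult[symmetric] ennreal_plus[symmetric] ennreal_leI del: ennreal_plus)
qed (auto simp: epow_top)

text \<open>Since \<open>inverse top = 0\<close>, an infinite exponent drops out of the relation and
  \<open>r\<close> equals the other exponent.\<close>

lemma ennreal_exponent_cases:
  fixes p q r :: ennreal
  assumes pq: "0 < p" "0 < q" and r: "r = inverse (inverse p + inverse q)"
  obtains (fin) P Q R where "0 < P" "0 < Q" "0 < R" "1 / R = 1 / P + 1 / Q"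
      "p = ennreal P" "q = ennreal Q" "r = ennreal R"
  | (left_top) Q where "0 < Q" "p = top" "q = ennreal Q" "r = ennreal Q"
  | (right_top) P where "0 < P" "p = ennreal P" "q = top" "r = ennreal P"
  | (top) "p = top" "q = top" "r = top"
proof (cases p; cases q)
  fix P Q assume *: "0 \<le> P" "p = ennreal P" "0 \<le> Q" "q = ennreal Q"
  then have P: "0 < P" "0 < Q" using pq by auto
  then have "r = ennreal (1 / (1 / P + 1 / Q))"
    using r * by (simp add: inverse_ennreal ennreal_plus[symmetric] inverse_eq_divide add_pos_pos del: ennreal_plus)
  then show thesis
    using P * by (intro fin[of P Q "1 / (1 / P + 1 / Q)"]) (auto intro!: divide_pos_pos add_pos_pos)
next
  fix Q assume *: "p = top" "0 \<le> Q" "q = ennreal Q"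
  then have "0 < Q" using pq by auto
  with * r show thesis by (intro left_top) (auto simp: inverse_ennreal)
next
  fix P assume *: "q = top" "0 \<le> P" "p = ennreal P"
  then have "0 < P" using pq by auto
  with * r show thesis by (intro right_top) (auto simp: inverse_ennreal)
next
  assume "p = top" "q = top"
  with r show thesis by (intro top) auto
qed

lemma HL_zero [simp]: "HL (\<lambda>_. 0) x = 0"
  unfolding HL_def by (auto intro!: antisym SUP_least)

lemma HL_one_le: "HL (\<lambda>_. 1) x \<le> 2"
  unfolding HL_def
proof (rule SUP_least)
  fix h :: real assume "h \<in> {h \<in> \<rat>. 0 < h}"
  then show "ennreal (1 / h) * (\<integral>\<^sup>+ y. 1 * indicator (ball x h) y \<partial>lborel) \<le> 2"
    by (simp add: ball_eq_greaterThanLessThan ennreal_mult[symmetric])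
qed

text \<open>\<open>M\<close> enters only through a measurable majorant. The constant combines
  \<open>2 powr R\<close> from \<open>epow_add_le\<close>, a 2 for the two summands, and the
  constant of \<open>HL_strong_type\<close>.\<close>

lemma Lpn_HL_add_le:
  assumes UV [measurable]: "U \<in> borel_measurable borel" "V \<in> borel_measurable borel"
    and R: "1 < R" and U: "(\<integral>\<^sup>+ x. epow (U x) R \<partial>lborel) \<le> 1" and V: "(\<integral>\<^sup>+ x. epow (V x) R \<partial>lborel) \<le> 1"
    and M: "\<And>x. M x \<le> E * (HL U x + HL V x)"
  shows "Lpn (ennreal R) M \<le> ennreal ((2 powr R * (2 * (20 * R / (R - 1) * 4 powr (R - 1)))) powr (1 / R)) * E"
proof -
  define k where "k = 20 * R / (R - 1) * 4 powr (R - 1)"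
  have k: "0 \<le> k" using R by (simp add: k_def)
  have HLU: "(\<integral>\<^sup>+ x. epow (HL U x) R \<partial>lborel) \<le> ennreal k * 1"
    unfolding k_def by (rule order_trans[OF HL_strong_type[OF UV(1) R] mult_left_mono[OF U]]) simp
  have HLV: "(\<integral>\<^sup>+ x. epow (HL V x) R \<partial>lborel) \<le> ennreal k * 1"
    unfolding k_def by (rule order_trans[OF HL_strong_type[OF UV(2) R] mult_left_mono[OF V]]) simp
  have "(\<integral>\<^sup>+ x. epow (M x) R \<partial>lborel)
      \<le> (\<integral>\<^sup>+ x. (epow E R * ennreal (2 powr R)) * (epow (HL U x) R + epow (HL V x) R) \<partial>lborel)"
  proof (rule nn_integral_mono)
    fix x
    have "epow (M x) R \<le> epow (E * (HL U x + HL V x)) R" using R by (intro epow_mono M) simp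
    also have "\<dots> \<le> epow E R * (ennreal (2 powr R) * (epow (HL U x) R + epow (HL V x) R))"
      using R by (simp add: epow_mult) (intro mult_left_mono epow_add_le, auto)
    finally show "epow (M x) R \<le> (epow E R * ennreal (2 powr R)) * (epow (HL U x) R + epow (HL V x) R)"
      by (simp add: mult.assoc)
  qed
  also have "\<dots> = (epow E R * ennreal (2 powr R)) * ((\<integral>\<^sup>+ x. epow (HL U x) R \<partial>lborel) + (\<integral>\<^sup>+ x. epow (HL V x) R \<partial>lborel))"
    by (subst nn_integral_cmult, measurable, subst nn_integral_add) simp_all
  also have "\<dots> \<le> (epow E R * ennreal (2 powr R)) * (ennreal k * 1 + ennreal k * 1)"
    by (intro mult_left_mono add_mono HLU HLV) simp
  also have "ennreal k * 1 + ennreal k * 1 = ennreal (2 * k)"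
    using k by (simp flip: ennreal_plus)
  also have "(epow E R * ennreal (2 powr R)) * ennreal (2 * k) = epow E R * ennreal (2 powr R * (2 * k))"
    using k by (simp add: ennreal_mult[of "2 powr R"] mult.assoc)
  finally have "Lpn (ennreal R) M \<le> epow (epow E R * ennreal (2 powr R * (2 * k))) (1 / R)"
    using R by (subst Lpn_ennreal) (auto intro!: epow_mono)
  also have "\<dots> = E * ennreal ((2 powr R * (2 * k)) powr (1 / R))"
    using R k by (simp add: epow_mult epow_epow epow_ennreal)
  finally show ?thesis by (simp add: k_def mult.commute)
qed

text \<open>The exponent relation makes \<open>P / R\<close> and \<open>Q / R\<close> conjugate, so that Young's
  inequality splits the product of the normalised functions into two functions with bounded
  \<open>L\<^sup>R\<close> norm.\<close>

lemma Lpn_product_split: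
  assumes F: "F \<in> borel_measurable borel" and G: "G \<in> borel_measurable borel"
    and pq: "0 < p" "0 < q" and R0: "0 < R" and r: "ennreal R = inverse (inverse p + inverse q)"
    and fin: "Lpn p F < top" "Lpn q G < top"
  obtains U V N1 N2 where "U \<in> borel_measurable borel" "V \<in> borel_measurable borel"
    "N1 \<in> null_sets lborel" "N2 \<in> null_sets lborel"
    "(\<integral>\<^sup>+ x. epow (U x) R \<partial>lborel) \<le> 1" "(\<integral>\<^sup>+ x. epow (V x) R \<partial>lborel) \<le> 1"
    "\<And>y z. y \<notin> N1 \<Longrightarrow> z \<notin> N2 \<Longrightarrow> F y * G z \<le> (Lpn p F * Lpn q G) * (U y + V z)"
proof -
  obtain W1 N1 where W1: "W1 \<in> borel_measurable borel" "N1 \<in> null_sets lborel"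
    "\<And>y. y \<notin> N1 \<Longrightarrow> F y \<le> Lpn p F * W1 y"
    "p \<noteq> top \<Longrightarrow> (\<integral>\<^sup>+ y. epow (W1 y) (enn2real p) \<partial>lborel) \<le> 1"
    "p = top \<Longrightarrow> W1 = (\<lambda>_. 1)"
    using Lpn_normalise[OF F pq(1) fin(1)] by blast
  obtain W2 N2 where W2: "W2 \<in> borel_measurable borel" "N2 \<in> null_sets lborel"
    "\<And>y. y \<notin> N2 \<Longrightarrow> G y \<le> Lpn q G * W2 y"
    "q \<noteq> top \<Longrightarrow> (\<integral>\<^sup>+ y. epow (W2 y) (enn2real q) \<partial>lborel) \<le> 1"
    "q = top \<Longrightarrow> W2 = (\<lambda>_. 1)"
    using Lpn_normalise[OF G pq(2) fin(2)] by blast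
  have FG: "F y * G z \<le> (Lpn p F * Lpn q G) * (U + V)"
    if "y \<notin> N1" "z \<notin> N2" "W1 y * W2 z \<le> U + V" for y z U V
  proof -
    have "F y * G z \<le> (Lpn p F * W1 y) * (Lpn q G * W2 z)"
      using that by (intro mult_mono W1 W2) auto
    also have "\<dots> = (Lpn p F * Lpn q G) * (W1 y * W2 z)" by (simp add: ac_simps)
    also have "\<dots> \<le> (Lpn p F * Lpn q G) * (U + V)" using that(3) by (rule mult_left_mono) simp
    finally show ?thesis .
  qed
  note [measurable] = W1(1) W2(1)
  from pq r show thesis
  proof (cases rule: ennreal_exponent_cases)
    case (fin P Q R')
    then have R: "0 < R" "R' = R" using R0 by (auto)
    define a b where "a = P / R" and "b = Q / R"
    have "1 / a + 1 / b = R * (1 / P + 1 / Q)"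
      by (simp add: a_def b_def distrib_left)
    also have "\<dots> = 1"
      using fin(3) unfolding fin(4)[symmetric] R by simp
    finally have ab: "1 / a + 1 / b = 1" .
    have pos: "0 < a" "0 < b" using fin R by (auto simp: a_def b_def)
    then have "0 < 1 / a" "0 < 1 / b" by simp_all
    with ab have "1 / a < 1" "1 / b < 1" by linarith+
    then have gt: "1 < a" "1 < b" using pos by (simp_all add: divide_less_eq_1_pos)
    show thesis
    proof (rule that[of "\<lambda>y. epow (W1 y) a" "\<lambda>z. epow (W2 z) b", OF _ _ W1(2) W2(2)])
      show "(\<integral>\<^sup>+ x. epow (epow (W1 x) a) R \<partial>lborel) \<le> 1"
        using W1(4) fin R by (simp add: epow_epow a_def)
      show "(\<integral>\<^sup>+ x. epow (epow (W2 x) b) R \<partial>lborel) \<le> 1"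
        using W2(4) fin R by (simp add: epow_epow b_def)
      show "F y * G z \<le> (Lpn p F * Lpn q G) * (epow (W1 y) a + epow (W2 z) b)"
        if "y \<notin> N1" "z \<notin> N2" for y z
        using FG[OF that Youngs_inequality_ennreal[OF gt ab]] .
    qed measurable
  next
    \<comment> \<open>Now \<open>W1\<close> is 1 and \<open>R = Q\<close>, so the product is already
      \<open>W2\<close> and \<open>U\<close> can be 0. The next case is symmetric; two infinite
      exponents would contradict a real \<open>R\<close>.\<close>
    case (left_top Q)
    then have R: "R = Q" using R0 by (simp)
    show thesis
      by (rule that[of "\<lambda>_. 0" W2, OF _ _ W1(2) W2(2)])
         (use left_top R W1(5) W2(4) FG[where U = 0] in auto)
  next
    case (right_top P)
    then have R: "R = P" using R0 by (simp)
    show thesis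
      by (rule that[of W1 "\<lambda>_. 0", OF _ _ W1(2) W2(2)])
         (use right_top R W2(5) W1(4) FG[where V = 0] in auto)
  qed simp
qed

lemma Mgamma_bounded:
  assumes smooth: "smooth_on {0<..<1} \<gamma>1" "smooth_on {0<..<1} \<gamma>2"
    and psi: "continuous_on UNIV \<psi>" "\<forall>s. 0 \<le> \<psi> s"
    and supp: "compact (supp \<psi>)" "supp \<psi> \<subseteq> {0<..<1}"
    and nondeg: "\<forall>s\<in>supp \<psi>. deriv \<gamma>1 s \<noteq> 0 \<and> deriv \<gamma>2 s \<noteq> 0"
    and pq: "0 < p" "0 < q" and r: "r = inverse (inverse p + inverse q)" "1 < r"
  shows "\<exists>C::real. \<forall>f g.
            f \<in> borel_measurable borel \<longrightarrow> g \<in> borel_measurable borel \<longrightarrow>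
            Lpn p (\<lambda>x. ennreal (norm (f x))) < top \<longrightarrow>
            Lpn q (\<lambda>x. ennreal (norm (g x))) < top \<longrightarrow>
            Lpn r (Mgamma \<gamma>1 \<gamma>2 \<psi> f g)
              \<le> ennreal C * Lpn p (\<lambda>x. ennreal (norm (f x))) * Lpn q (\<lambda>x. ennreal (norm (g x)))"
proof (rule Mgamma_le_HL[OF smooth psi supp nondeg])
  fix C :: real
  assume C: "0 \<le> C"
    "\<And>f g U V D N1 N2 x. U \<in> borel_measurable borel \<Longrightarrow> V \<in> borel_measurable borel \<Longrightarrow>
       N1 \<in> null_sets lborel \<Longrightarrow> N2 \<in> null_sets lborel \<Longrightarrow>
       (\<And>y z. y \<notin> N1 \<Longrightarrow> z \<notin> N2 \<Longrightarrow> ennreal (norm (f y)) * ennreal (norm (g z)) \<le> D * (U y + V z)) \<Longrightarrow>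
       Mgamma \<gamma>1 \<gamma>2 \<psi> f g x \<le> ennreal C * (D * (HL U x + HL V x))"
  show ?thesis
  proof (cases r)
    case (real R)
    then have R: "1 < R" using r(2) by (metis ennreal_1 ennreal_less_iff zero_le_one)
    define k where "k = (2 powr R * (2 * (20 * R / (R - 1) * 4 powr (R - 1)))) powr (1 / R)"
    show ?thesis
    proof (intro exI[of _ "k * C"] allI impI)
      fix f g :: "real \<Rightarrow> complex"
      assume [measurable]: "f \<in> borel_measurable borel" "g \<in> borel_measurable borel"
        and fin: "Lpn p (\<lambda>x. ennreal (norm (f x))) < top" "Lpn q (\<lambda>x. ennreal (norm (g x))) < top"
      let ?A = "Lpn p (\<lambda>x. ennreal (norm (f x)))" and ?B = "Lpn q (\<lambda>x. ennreal (norm (g x)))"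
      have meas: "(\<lambda>x. ennreal (norm (f x))) \<in> borel_measurable borel" "(\<lambda>x. ennreal (norm (g x))) \<in> borel_measurable borel"
        by measurable
      obtain U V N1 N2 where UV: "U \<in> borel_measurable borel" "V \<in> borel_measurable borel"
        "N1 \<in> null_sets lborel" "N2 \<in> null_sets lborel"
        "(\<integral>\<^sup>+ x. epow (U x) R \<partial>lborel) \<le> 1" "(\<integral>\<^sup>+ x. epow (V x) R \<partial>lborel) \<le> 1"
        "\<And>y z. y \<notin> N1 \<Longrightarrow> z \<notin> N2 \<Longrightarrow> ennreal (norm (f y)) * ennreal (norm (g z)) \<le> (?A * ?B) * (U y + V z)"
        by (rule Lpn_product_split[OF meas pq _ r(1)[unfolded real] fin]) (use R in simp, rule that)
      have M: "Mgamma \<gamma>1 \<gamma>2 \<psi> f g x \<le> (ennreal C * (?A * ?B)) * (HL U x + HL V x)" for x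
        using C(2)[OF UV(1-4,7)] by (simp add: mult.assoc)
      have "Lpn r (Mgamma \<gamma>1 \<gamma>2 \<psi> f g) \<le> ennreal k * (ennreal C * (?A * ?B))"
        unfolding real k_def by (rule Lpn_HL_add_le[OF UV(1,2) R UV(5,6) M])
      also have "\<dots> = ennreal (k * C) * ?A * ?B"
        using C(1) by (simp add: k_def ennreal_mult mult.assoc)
      finally show "Lpn r (Mgamma \<gamma>1 \<gamma>2 \<psi> f g) \<le> ennreal (k * C) * ?A * ?B" .
    qed
  next
    \<comment> \<open>Both exponents are infinite, so the product of norms bounds the product of
      functions almost everywhere. The splitting then takes \<open>U = 1\<close> and
      \<open>V = 0\<close>, and the maximal function of 1 is at most 2 because averages are
      normalised by the radius.\<close>
    case top
    with pq r(1) have pq_top: "p = top" "q = top"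
      by (cases rule: ennreal_exponent_cases[OF pq r(1)]; simp)+
    show ?thesis
    proof (intro exI[of _ "C * 2"] allI impI)
      fix f g :: "real \<Rightarrow> complex"
      assume [measurable]: "f \<in> borel_measurable borel" "g \<in> borel_measurable borel"
      let ?A = "Lpn p (\<lambda>x. ennreal (norm (f x)))" and ?B = "Lpn q (\<lambda>x. ennreal (norm (g x)))"
      let ?N1 = "{x. \<not> ennreal (norm (f x)) \<le> ?A}" and ?N2 = "{x. \<not> ennreal (norm (g x)) \<le> ?B}"
      have N: "?N1 \<in> null_sets lborel" "?N2 \<in> null_sets lborel"
        using AE_le_Lpn_top[of "\<lambda>x. ennreal (norm (f x))"] AE_le_Lpn_top[of "\<lambda>x. ennreal (norm (g x))"]
        unfolding pq_top by (subst AE_iff_null_sets; simp)+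
      have "Mgamma \<gamma>1 \<gamma>2 \<psi> f g x \<le> ennreal (C * 2) * ?A * ?B" for x
      proof -
        have "Mgamma \<gamma>1 \<gamma>2 \<psi> f g x \<le> ennreal C * ((?A * ?B) * (HL (\<lambda>_. 1) x + HL (\<lambda>_. 0) x))"
          by (rule C(2)[OF _ _ N]) (auto intro!: mult_mono)
        also have "\<dots> \<le> ennreal C * ((?A * ?B) * 2)"
          using HL_one_le by (intro mult_left_mono) auto
        also have "\<dots> = ennreal (C * 2) * ?A * ?B"
          using C(1) by (simp add: ennreal_mult ac_simps)
        finally show ?thesis .
      qed
      then show "Lpn r (Mgamma \<gamma>1 \<gamma>2 \<psi> f g) \<le> ennreal (C * 2) * ?A * ?B"
        unfolding top by (rule Lpn_top_le)
    qed
  qed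
qed

section \<open>Test functions and the failure for exponents at most one\<close>

text \<open>A zero with nonvanishing derivative is isolated. This allows the base parameter to be
  moved off the zeros of both coordinates of the curve.\<close>

lemma eventually_nonzero_at:
  fixes g :: "real \<Rightarrow> real"
  assumes g: "(g has_real_derivative d) (at a)" and d: "d \<noteq> 0"
  shows "\<forall>\<^sub>F s in at a. g s \<noteq> 0"
proof (cases "g a = 0")
  case True
  have "((\<lambda>s. (g s - g a) / (s - a)) \<longlongrightarrow> d) (at a)"
    using g by (simp add: has_field_derivative_iff)
  then have "\<forall>\<^sub>F s in at a. (g s - g a) / (s - a) \<noteq> 0"
    using d by (rule tendsto_imp_eventually_ne)
  then show ?thesis by eventually_elim (use True in auto)
next
  case False
  have "isCont g a" using g by (rule DERIV_isCont)
  then show ?thesis using False unfolding isCont_def by (rule tendsto_imp_eventually_ne)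
qed

lemma eventually_le_linear_at:
  fixes g :: "real \<Rightarrow> real"
  assumes g: "(g has_real_derivative d) (at a)" and L: "\<bar>d\<bar> < L"
  shows "\<forall>\<^sub>F s in at a. \<bar>g s - g a\<bar> \<le> L * \<bar>s - a\<bar>"
proof -
  have "((\<lambda>s. (g s - g a) / (s - a)) \<longlongrightarrow> d) (at a)"
    using g by (simp add: has_field_derivative_iff)
  then have "((\<lambda>s. \<bar>(g s - g a) / (s - a)\<bar>) \<longlongrightarrow> \<bar>d\<bar>) (at a)"
    by (rule tendsto_rabs)
  then have "\<forall>\<^sub>F s in at a. \<bar>(g s - g a) / (s - a)\<bar> < L"
    using L by (rule order_tendstoD)
  moreover have "\<forall>\<^sub>F s in at a. s \<noteq> a" by (auto simp: eventually_at intro: exI[of _ 1])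
  ultimately show ?thesis
    by eventually_elim (auto simp: abs_divide divide_less_eq)
qed

text \<open>Reduces an infinite \<open>p\<close> with finite \<open>q\<close> to the opposite
  situation.\<close>

lemma Mgamma_swap: "Mgamma \<gamma>1 \<gamma>2 \<psi> f g x = Mgamma \<gamma>2 \<gamma>1 \<psi> g f x"
proof -
  have "Mgamma \<gamma>1 \<gamma>2 \<psi> f g x \<le> Mgamma \<gamma>2 \<gamma>1 \<psi> g f x" for \<gamma>1 \<gamma>2 f g
    unfolding Mgamma_def
  proof (rule SUP_least)
    fix t :: "real \<times> real" assume "t \<in> {0<..} \<times> {0<..}"
    then have "prod.swap t \<in> {0<..} \<times> {0<..}" by auto
    then show "ennreal (norm (LINT s|lborel. f (x - fst t * \<gamma>1 s) * g (x - snd t * \<gamma>2 s) * complex_of_real (\<psi> s)))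
      \<le> (SUP t\<in>{0<..} \<times> {0<..}. ennreal (norm (LINT s|lborel. g (x - fst t * \<gamma>2 s) * f (x - snd t * \<gamma>1 s) * complex_of_real (\<psi> s))))"
      by (rule SUP_upper2) (simp add: mult.commute)
  qed
  then show ?thesis by (intro antisym)
qed

lemma Mgamma_indicator_ge:
  assumes cont: "continuous_on (supp \<psi>) \<gamma>1" "continuous_on (supp \<psi>) \<gamma>2"
    and psi: "continuous_on UNIV \<psi>" "\<forall>s. 0 \<le> \<psi> s" and supp: "compact (supp \<psi>)"
    and sets [measurable]: "A \<in> sets borel" "B \<in> sets borel"
    and t: "0 < t1" "0 < t2" and c: "0 \<le> c" and e: "0 \<le> e"
    and near: "\<And>s. \<bar>s - s0\<bar> \<le> e \<Longrightarrow> c \<le> \<psi> s \<and> x - t1 * \<gamma>1 s \<in> A \<and> x - t2 * \<gamma>2 s \<in> B"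
  shows "ennreal (2 * c * e) \<le> Mgamma \<gamma>1 \<gamma>2 \<psi> (indicator A) (indicator B) x"
proof -
  let ?K = "supp \<psi>"
  define \<phi> where "\<phi> s = indicator A (x - t1 * \<gamma>1 s) * indicator B (x - t2 * \<gamma>2 s) * \<psi> s" for s
  have psi0: "\<psi> s = 0" if "s \<notin> ?K" for s
    using that closure_subset[of "{x. \<psi> x \<noteq> 0}"] by (auto simp: supp_def)
  have [measurable]: "?K \<in> sets borel" using supp by (simp add: borel_compact)
  have [measurable]: "(\<lambda>s. if s \<in> ?K then \<gamma>1 s else 0) \<in> borel_measurable borel"
    "(\<lambda>s. if s \<in> ?K then \<gamma>2 s else 0) \<in> borel_measurable borel"
    by (intro borel_measurable_continuous_on_if cont continuous_on_const; simp)+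
  have [measurable]: "\<psi> \<in> borel_measurable borel"
    using psi(1) by (rule borel_measurable_continuous_onI)
  have "\<phi> = (\<lambda>s. indicator A (x - t1 * (if s \<in> ?K then \<gamma>1 s else 0)) *
      indicator B (x - t2 * (if s \<in> ?K then \<gamma>2 s else 0)) * \<psi> s)"
    by (auto simp: \<phi>_def fun_eq_iff psi0)
  also have "\<dots> \<in> borel_measurable borel" by measurable
  finally have [measurable]: "\<phi> \<in> borel_measurable borel" .
  have "integrable lborel (\<lambda>s. indicator ?K s *\<^sub>R \<psi> s)"
    using supp continuous_on_subset[OF psi(1)] by (intro borel_integrable_compact) auto
  also have "(\<lambda>s. indicator ?K s *\<^sub>R \<psi> s) = \<psi>"
    by (auto simp: fun_eq_iff psi0 split: split_indicator)
  \<comment> \<open>Integrability is essential for a lower bound, since a non-integrable function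
    would have integral 0; it follows from domination by \<open>\<psi>\<close>.\<close>
  finally have int: "integrable lborel \<phi>"
    by (rule Bochner_Integration.integrable_bound) (use psi(2) in \<open>auto simp: \<phi>_def split: split_indicator\<close>)
  have "2 * c * e = (LINT s|lborel. c * indicator {s0 - e..s0 + e} s)"
    using e by simp
  also have "\<dots> \<le> (LINT s|lborel. \<phi> s)"
  proof (rule integral_mono)
    show "c * indicator {s0 - e..s0 + e} s \<le> \<phi> s" for s
      using near[of s] psi(2) by (auto simp: \<phi>_def abs_le_iff split: split_indicator)
  next
    have "integrable lborel (indicator {s0 - e..s0 + e} :: real \<Rightarrow> real)"
      using e by (intro integrable_real_indicator) auto
    then show "integrable lborel (\<lambda>s. c * indicator {s0 - e..s0 + e} s)" by simp
  qed (rule int)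
  also have "\<dots> \<le> norm (complex_of_real (LINT s|lborel. \<phi> s))" by simp
  also have "complex_of_real (LINT s|lborel. \<phi> s) = (LINT s|lborel. complex_of_real (\<phi> s))"
    by simp
  also have "(\<lambda>s. complex_of_real (\<phi> s)) =
      (\<lambda>s. indicator A (x - t1 * \<gamma>1 s) * indicator B (x - t2 * \<gamma>2 s) * complex_of_real (\<psi> s))"
    by (auto simp: \<phi>_def fun_eq_iff split: split_indicator)
  finally have "ennreal (2 * c * e) \<le> ennreal (norm (LINT s|lborel.
      indicator A (x - t1 * \<gamma>1 s) * indicator B (x - t2 * \<gamma>2 s) * complex_of_real (\<psi> s)))"
    by (rule ennreal_leI)
  also have "\<dots> \<le> Mgamma \<gamma>1 \<gamma>2 \<psi> (indicator A) (indicator B) x"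
    unfolding Mgamma_def using t by (intro SUP_upper2[of "(t1, t2)"]) auto
  finally show ?thesis .
qed

text \<open>The dilation parameters are chosen so that the curve passes through \<open>(x, x - y)\<close>
  after dilation, at a parameter where neither coordinate vanishes; the sign conditions
  make them positive.\<close>

lemma Mgamma_indicator_ball_ge:
  assumes smooth: "smooth_on {0<..<1} \<gamma>1" "smooth_on {0<..<1} \<gamma>2"
    and psi: "continuous_on UNIV \<psi>" "\<forall>s. 0 \<le> \<psi> s" "\<exists>s. \<psi> s \<noteq> 0"
    and supp: "compact (supp \<psi>)" "supp \<psi> \<subseteq> {0<..<1}"
    and nondeg: "\<forall>s\<in>supp \<psi>. deriv \<gamma>1 s \<noteq> 0 \<and> deriv \<gamma>2 s \<noteq> 0"
  obtains \<kappa> s0 where "0 < \<kappa>" "\<gamma>1 s0 \<noteq> 0" "\<gamma>2 s0 \<noteq> 0"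
    "\<And>x y B. 1 \<le> \<bar>x\<bar> \<Longrightarrow> 0 < x * \<gamma>1 s0 \<Longrightarrow> 0 < (x - y) * \<gamma>2 s0 \<Longrightarrow> \<bar>x - y\<bar> \<le> \<bar>x\<bar> \<Longrightarrow>
       B \<in> sets borel \<Longrightarrow> cball y 1 \<subseteq> B \<Longrightarrow>
       ennreal (\<kappa> / \<bar>x\<bar>) \<le> Mgamma \<gamma>1 \<gamma>2 \<psi> (indicator (cball 0 1)) (indicator B) x"
proof -
  have in_supp: "s \<in> supp \<psi>" if "\<psi> s \<noteq> 0" for s
    using that closure_subset[of "{x. \<psi> x \<noteq> 0}"] by (auto simp: supp_def)
  have cpsi: "isCont \<psi> s" for s using psi(1) by (simp add: continuous_on_eq_continuous_at)
  \<comment> \<open>At \<open>a\<close> itself a coordinate may vanish, and no dilation would then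
    steer that coordinate; a nearby \<open>s0\<close> avoids this while keeping
    \<open>\<psi>\<close> positive.\<close>
  obtain a where a: "0 < \<psi> a" using psi(2,3) by (metis less_eq_real_def)
  have da: "a \<in> supp \<psi>" "a \<in> {0<..<1}" using a in_supp supp(2) by force+
  have ev: "\<forall>\<^sub>F s in at a. 0 < \<psi> s" using cpsi[of a] a unfolding isCont_def by (rule order_tendstoD)
  have "\<forall>\<^sub>F s in at a. 0 < \<psi> s \<and> \<gamma>1 s \<noteq> 0 \<and> \<gamma>2 s \<noteq> 0"
    using ev eventually_nonzero_at[OF smooth_on_has_real_derivative[OF smooth(1) da(2)]]
      eventually_nonzero_at[OF smooth_on_has_real_derivative[OF smooth(2) da(2)]] nondeg da(1)
    by (auto simp: eventually_conj_iff)
  then obtain s0 where s0: "0 < \<psi> s0" "\<gamma>1 s0 \<noteq> 0" "\<gamma>2 s0 \<noteq> 0"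
    using eventually_happens[of _ "at a"] by auto
  have s0_in: "s0 \<in> {0<..<1}" using s0 in_supp supp(2) by force
  define L where "L = max \<bar>deriv \<gamma>1 s0\<bar> \<bar>deriv \<gamma>2 s0\<bar> + 1"
  have L: "0 < L" "\<bar>deriv \<gamma>1 s0\<bar> < L" "\<bar>deriv \<gamma>2 s0\<bar> < L" by (auto simp: L_def)
  define c where "c = \<psi> s0 / 2"
  have c: "0 < c" "c < \<psi> s0" using s0 by (auto simp: c_def)
  have "\<forall>\<^sub>F s in at s0. c < \<psi> s" using cpsi[of s0] c(2) unfolding isCont_def by (rule order_tendstoD)
  then have "\<forall>\<^sub>F s in at s0. c < \<psi> s \<and> \<bar>\<gamma>1 s - \<gamma>1 s0\<bar> \<le> L * \<bar>s - s0\<bar> \<and> \<bar>\<gamma>2 s - \<gamma>2 s0\<bar> \<le> L * \<bar>s - s0\<bar>"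
    using eventually_le_linear_at[OF smooth_on_has_real_derivative[OF smooth(1) s0_in] L(2)]
      eventually_le_linear_at[OF smooth_on_has_real_derivative[OF smooth(2) s0_in] L(3)]
    by (auto simp: eventually_conj_iff)
  then obtain d where d: "0 < d" and dd: "\<And>s. s \<noteq> s0 \<Longrightarrow> dist s s0 < d \<Longrightarrow>
      c < \<psi> s \<and> \<bar>\<gamma>1 s - \<gamma>1 s0\<bar> \<le> L * \<bar>s - s0\<bar> \<and> \<bar>\<gamma>2 s - \<gamma>2 s0\<bar> \<le> L * \<bar>s - s0\<bar>"
    unfolding eventually_at by auto
  have near: "c \<le> \<psi> s" "\<bar>\<gamma>1 s - \<gamma>1 s0\<bar> \<le> L * \<bar>s - s0\<bar>" "\<bar>\<gamma>2 s - \<gamma>2 s0\<bar> \<le> L * \<bar>s - s0\<bar>"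
    if "\<bar>s - s0\<bar> < d" for s
    using dd[of s] that c by (cases "s = s0"; auto simp: dist_real_def)+
  define m where "m = min \<bar>\<gamma>1 s0\<bar> \<bar>\<gamma>2 s0\<bar>"
  have m: "0 < m" "m \<le> \<bar>\<gamma>1 s0\<bar>" "m \<le> \<bar>\<gamma>2 s0\<bar>" using s0 by (auto simp: m_def)
  \<comment> \<open>\<open>d / 2\<close> keeps the parameters where the linear estimates hold;
    \<open>m / L\<close> keeps the dilated curve within distance 1 of its target.\<close>
  define \<mu> where "\<mu> = min (d / 2) (m / L)"
  have \<mu>: "0 < \<mu>" "\<mu> < d" "L * \<mu> \<le> m" using d m L by (auto simp: \<mu>_def min_def field_simps)
  have cont: "continuous_on (supp \<psi>) \<gamma>1" "continuous_on (supp \<psi>) \<gamma>2"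
    using smooth[THEN smooth_on_continuous_on] supp(2) by (auto intro: continuous_on_subset)
  show thesis
  proof (rule that[of "2 * c * \<mu>" s0])
    show "0 < 2 * c * \<mu>" using c \<mu> by simp
    fix x y :: real and B
    assume x: "1 \<le> \<bar>x\<bar>" and sgn: "0 < x * \<gamma>1 s0" "0 < (x - y) * \<gamma>2 s0" and xy: "\<bar>x - y\<bar> \<le> \<bar>x\<bar>"
      and B [measurable]: "B \<in> sets borel" and sub: "cball y 1 \<subseteq> B"
    \<comment> \<open>Dilations have size at most \<open>\<bar>x\<bar> / m\<close>, so a parameter
      error \<open>e\<close> moves the points by at most \<open>\<bar>x\<bar> / m * (L * e)\<close>,
      that is \<open>L * \<mu> / m\<close>. The condition
      \<open>\<bar>x - y\<bar> \<le> \<bar>x\<bar>\<close> lets one \<open>e\<close> serve both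
      coordinates.\<close>
    define e where "e = \<mu> / \<bar>x\<bar>"
    have e: "0 < e" "e \<le> \<mu>" "\<bar>x\<bar> * e = \<mu>" using x \<mu> by (auto simp: e_def field_simps)
    have small: "\<bar>z - (z / w) * v\<bar> \<le> 1"
      if z: "\<bar>z\<bar> \<le> \<bar>x\<bar>" and w: "w \<noteq> 0" "m \<le> \<bar>w\<bar>" and v: "\<bar>v - w\<bar> \<le> L * e" for z v w :: real
    proof -
      have "z - (z / w) * v = (z / w) * (w - v)" using w by (simp add: field_simps)
      then have "\<bar>z - (z / w) * v\<bar> = \<bar>z\<bar> / \<bar>w\<bar> * \<bar>v - w\<bar>"
        by (simp add: abs_mult abs_divide abs_minus_commute)
      also have "\<dots> \<le> \<bar>x\<bar> / m * (L * e)"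
        using z w v m by (intro mult_mono frac_le) auto
      also have "\<dots> = L * \<mu> / m" using e(3) by (simp add: field_simps)
      also have "\<dots> \<le> 1" using \<mu>(3) m by simp
      finally show ?thesis .
    qed
    have "ennreal (2 * c * e) \<le> Mgamma \<gamma>1 \<gamma>2 \<psi> (indicator (cball 0 1)) (indicator B) x"
    proof (rule Mgamma_indicator_ge[OF cont psi(1,2) supp(1)])
      show "0 < x / \<gamma>1 s0" "0 < (x - y) / \<gamma>2 s0"
        using sgn by (simp_all add: zero_less_divide_iff zero_less_mult_iff)
      fix s assume s: "\<bar>s - s0\<bar> \<le> e"
      then have sd: "\<bar>s - s0\<bar> < d" using e \<mu> by linarith
      have Le: "L * \<bar>s - s0\<bar> \<le> L * e" using s L by simp
      have "\<bar>x - (x / \<gamma>1 s0) * \<gamma>1 s\<bar> \<le> 1"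
        using near(2)[OF sd] Le m s0 by (intro small) auto
      moreover have "\<bar>(x - y) - ((x - y) / \<gamma>2 s0) * \<gamma>2 s\<bar> \<le> 1"
        using near(3)[OF sd] Le m s0 xy by (intro small) auto
      then have "x - ((x - y) / \<gamma>2 s0) * \<gamma>2 s \<in> cball y 1"
        by (simp add: dist_real_def abs_minus_commute algebra_simps)
      ultimately show "c \<le> \<psi> s \<and> x - x / \<gamma>1 s0 * \<gamma>1 s \<in> cball 0 1 \<and> x - (x - y) / \<gamma>2 s0 * \<gamma>2 s \<in> B"
        using near(1)[OF sd] sub by auto
    qed (use c e in auto)
    then show "ennreal (2 * c * \<mu> / \<bar>x\<bar>) \<le> Mgamma \<gamma>1 \<gamma>2 \<psi> (indicator (cball 0 1)) (indicator B) x"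
      by (simp add: e_def)
  qed (use s0 in auto)
qed

section \<open>Lacunary test functions\<close>

lemma Lpn_indicator:
  assumes A [measurable]: "A \<in> sets borel" and p: "0 < P"
  shows "Lpn (ennreal P) (\<lambda>x. ennreal (norm (indicator A x :: complex))) = epow (emeasure lborel A) (1 / P)"
proof -
  have "epow (ennreal (norm (indicator A x :: complex))) P = indicator A x" for x
    by (auto split: split_indicator)
  then show ?thesis using p by (simp add: Lpn_ennreal)
qed

lemma ex_power_two_interval:
  assumes "1 \<le> (u::real)"
  obtains k :: nat where "2 ^ k \<le> u" "u < 2 ^ Suc k"
proof -
  define k where "k = nat \<lfloor>log 2 u\<rfloor>"
  have "0 \<le> log 2 u" using assms by simp
  then have "real k \<le> log 2 u" "log 2 u < real (Suc k)"
    by (auto simp: k_def) linarith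
  then have "2 powr real k \<le> u" "u < 2 powr real (Suc k)"
    using assms by (auto simp: le_log_iff log_less_iff simp del: of_nat_Suc)
  then show thesis by (intro that[of k]) (auto simp: powr_realpow simp del: of_nat_Suc)
qed

text \<open>\<open>\<sigma>\<close> picks the half-line on which the lower bound holds; reflecting
  by it leaves the integral of \<open>a / u\<close>, worth \<open>a * ln 2\<close> per dyadic
  range.\<close>

lemma nn_integral_inverse_two_power:
  fixes \<sigma> :: real
  assumes s: "\<bar>\<sigma>\<bar> = 1" and a: "0 \<le> a"
  shows "(\<integral>\<^sup>+ x. ennreal (a / \<bar>x\<bar>) * indicator {x. 1 \<le> \<sigma> * x \<and> \<sigma> * x \<le> 2 ^ N} x \<partial>lborel)
    = ennreal (a * (real N * ln 2))"
proof -
  have ss: "\<sigma> * (\<sigma> * u) = u" for u using s by (auto simp: abs_if split: if_splits)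
  have "(\<integral>\<^sup>+ x. ennreal (a / \<bar>x\<bar>) * indicator {x. 1 \<le> \<sigma> * x \<and> \<sigma> * x \<le> 2 ^ N} x \<partial>lborel)
     = (\<integral>\<^sup>+ u. ennreal (a / \<bar>u\<bar>) * indicator {x. 1 \<le> \<sigma> * x \<and> \<sigma> * x \<le> 2 ^ N} (\<sigma> * u) \<partial>lborel)"
    using s by (subst nn_integral_real_affine[where c = \<sigma> and t = 0]) (auto simp: abs_mult)
  also have "\<dots> = (\<integral>\<^sup>+ u. ennreal (a / u) * indicator {1..2 ^ N} u \<partial>lborel)"
    by (intro nn_integral_cong) (auto simp: ss split: split_indicator)
  also have "\<dots> = ennreal (a * ln (2 ^ N) - a * ln 1)"
    by (rule nn_integral_FTC_Icc) (use a in \<open>auto intro!: derivative_eq_intros\<close>)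
  finally show ?thesis by (simp add: ln_realpow)
qed

text \<open>The lacunary centres are needed only when the two coordinates have opposite signs at the chosen
  parameter; otherwise the centre \<open>0\<close> alone suffices.\<close>

lemma Mgamma_unbounded:
  assumes smooth: "smooth_on {0<..<1} \<gamma>1" "smooth_on {0<..<1} \<gamma>2"
    and psi: "continuous_on UNIV \<psi>" "\<forall>s. 0 \<le> \<psi> s" "\<exists>s. \<psi> s \<noteq> 0"
    and supp: "compact (supp \<psi>)" "supp \<psi> \<subseteq> {0<..<1}"
    and nondeg: "\<forall>s\<in>supp \<psi>. deriv \<gamma>1 s \<noteq> 0 \<and> deriv \<gamma>2 s \<noteq> 0"
    and P: "0 < P" and R: "0 < R" "R \<le> 1" and b: "1 / R = 1 / P + b"
    and q: "(0 < b \<and> q = ennreal (1 / b)) \<or> (b = 0 \<and> q = top)"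
    and bounded: "\<And>f g.
            f \<in> borel_measurable borel \<Longrightarrow> g \<in> borel_measurable borel \<Longrightarrow>
            Lpn (ennreal P) (\<lambda>x. ennreal (norm (f x))) < top \<Longrightarrow>
            Lpn q (\<lambda>x. ennreal (norm (g x))) < top \<Longrightarrow>
            Lpn (ennreal R) (Mgamma \<gamma>1 \<gamma>2 \<psi> f g)
              \<le> ennreal C * Lpn (ennreal P) (\<lambda>x. ennreal (norm (f x))) * Lpn q (\<lambda>x. ennreal (norm (g x)))"
  shows False
proof (rule Mgamma_indicator_ball_ge[OF smooth psi supp nondeg])
  fix \<kappa> s0
  assume \<kappa>: "0 < \<kappa>" and nz: "\<gamma>1 s0 \<noteq> 0" "\<gamma>2 s0 \<noteq> 0"
    and ge: "\<And>x y B. 1 \<le> \<bar>x\<bar> \<Longrightarrow> 0 < x * \<gamma>1 s0 \<Longrightarrow> 0 < (x - y) * \<gamma>2 s0 \<Longrightarrow> \<bar>x - y\<bar> \<le> \<bar>x\<bar> \<Longrightarrow>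
       B \<in> sets borel \<Longrightarrow> cball y 1 \<subseteq> B \<Longrightarrow>
       ennreal (\<kappa> / \<bar>x\<bar>) \<le> Mgamma \<gamma>1 \<gamma>2 \<psi> (indicator (cball 0 1)) (indicator B) x"
  define \<sigma> where "\<sigma> = sgn (\<gamma>1 s0)"
  have \<sigma>: "\<bar>\<sigma>\<bar> = 1" "0 < \<sigma> * \<gamma>1 s0" "\<sigma> * \<sigma> = 1" using nz by (auto simp: \<sigma>_def sgn_if)
  \<comment> \<open>\<open>b\<close> plays the role of the reciprocal of \<open>q\<close>, with 0
    for an infinite exponent.\<close>
  have b0: "0 \<le> b" using q by auto
  \<comment> \<open>Collects the norm of the first indicator, supported on length 2, and that of the
    second, at most \<open>(8 * real N) powr b\<close>. The maximum guards against a negative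
    \<open>C\<close>.\<close>
  define D where "D = max C 0 * 2 powr (1 / P) * 8 powr b"
  have main: "\<kappa> * (real N * ln 2) powr (1 / R) \<le> D * real N powr b" if N: "1 \<le> N" for N :: nat
  proof -
    \<comment> \<open>A point of [2^k, 2^(k+1)) uses the right endpoint as centre, and k = N occurs,
      hence the exponent \<open>Suc N\<close>. With 0 there are at most N + 3 centres, each
      contributing length 2, and 2 * (N + 3) is at most 8 * N.\<close>
    define Y where "Y = insert 0 ((\<lambda>k. \<sigma> * 2 ^ k) ` {..Suc N})"
    define G where "G = (\<Union>y\<in>Y. cball y (1::real))"
    have finY: "finite Y" by (simp add: Y_def)
    have "card Y \<le> Suc (card ((\<lambda>k. \<sigma> * 2 ^ k) ` {..Suc N}))" unfolding Y_def by (rule card_insert_le_m1) auto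
    also have "\<dots> \<le> Suc (card {..Suc N})" by (intro Suc_leI le_imp_less_Suc card_image_le) simp
    finally have cardY: "card Y \<le> N + 3" by simp
    have G [measurable]: "G \<in> sets borel"
      unfolding G_def using finY by (intro sets.finite_UN) auto
    have "emeasure lborel G \<le> (\<Sum>y\<in>Y. emeasure lborel (cball y 1))"
      unfolding G_def using finY by (intro emeasure_subadditive_finite) auto
    also have "\<dots> = ennreal (2 * real (card Y))"
      by (simp add: cball_eq_atLeastAtMost ennreal_mult ennreal_of_nat_eq_real_of_nat mult.commute)
    also have "\<dots> \<le> ennreal (8 * real N)"
      using cardY N by (intro ennreal_leI) linarith
    finally have emG: "emeasure lborel G \<le> ennreal (8 * real N)" .
    have lower: "ennreal (\<kappa> / \<bar>x\<bar>) \<le> Mgamma \<gamma>1 \<gamma>2 \<psi> (indicator (cball 0 1)) (indicator G) x"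
      if x: "1 \<le> \<sigma> * x" "\<sigma> * x \<le> 2 ^ N" for x
    proof -
      define u where "u = \<sigma> * x"
      have u: "1 \<le> u" "u \<le> 2 ^ N" using x by (auto simp: u_def)
      have xu: "x = \<sigma> * u" using \<sigma>(3) by (simp add: u_def mult.assoc[symmetric])
      have absx: "\<bar>x\<bar> = u" using u \<sigma>(1) by (simp add: xu abs_mult)
      have pos: "0 < x * \<gamma>1 s0" using u \<sigma>(2) by (simp add: xu mult.assoc mult.left_commute[of \<sigma>])
      show ?thesis
      proof (cases "0 < \<sigma> * \<gamma>2 s0")
        case True
        then have "0 < (x - 0) * \<gamma>2 s0" using u by (simp add: xu mult.assoc mult.left_commute[of \<sigma>])
        moreover have "cball 0 1 \<subseteq> G" by (auto simp: G_def Y_def)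
        ultimately show ?thesis
          using ge[of x 0 G] pos absx u by auto
      next
        case False
        then have neg: "\<sigma> * \<gamma>2 s0 < 0" using nz \<sigma>(1) by (metis abs_zero linorder_neqE_linordered_idom mult_eq_0_iff zero_neq_one)
        \<comment> \<open>The next power of two lies beyond \<open>u\<close>, so the difference has
          the opposite sign, and \<open>2 ^ k \<le> u\<close> keeps its size at most
          \<open>u\<close>.\<close>
        obtain k where k: "2 ^ k \<le> u" "u < 2 ^ Suc k" using ex_power_two_interval[OF u(1)] .
        have "(2::real) ^ k \<le> 2 ^ N" using k u by linarith
        then have "k \<le> N" by simp
        then have "\<sigma> * 2 ^ Suc k \<in> Y" unfolding Y_def by (intro insertI2 imageI) simp
        then have sub: "cball (\<sigma> * 2 ^ Suc k) 1 \<subseteq> G" unfolding G_def by (rule UN_upper)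
        have eq: "x - \<sigma> * 2 ^ Suc k = \<sigma> * (u - 2 ^ Suc k)" by (simp add: xu algebra_simps)
        have "0 < (x - \<sigma> * 2 ^ Suc k) * \<gamma>2 s0"
          unfolding eq using neg k(2) mult_neg_neg[of "u - 2 ^ Suc k" "\<sigma> * \<gamma>2 s0"] by (simp add: ac_simps)
        moreover have "\<bar>x - \<sigma> * 2 ^ Suc k\<bar> \<le> \<bar>x\<bar>"
          unfolding eq absx using k \<sigma>(1) by (simp add: abs_mult)
        ultimately show ?thesis using ge[of x "\<sigma> * 2 ^ Suc k" G] pos absx u sub by auto
      qed
    qed
    let ?f = "indicator (cball 0 1) :: real \<Rightarrow> complex" and ?g = "indicator G :: real \<Rightarrow> complex"
    have f: "Lpn (ennreal P) (\<lambda>x. ennreal (norm (?f x))) = ennreal (2 powr (1 / P))"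
      using P epow_ennreal[of 2 "1 / P"] by (subst Lpn_indicator) (auto simp: cball_eq_atLeastAtMost)
    have g: "Lpn q (\<lambda>x. ennreal (norm (?g x))) \<le> ennreal ((8 * real N) powr b)"
      using q
    proof
      assume b: "0 < b \<and> q = ennreal (1 / b)"
      then have "Lpn q (\<lambda>x. ennreal (norm (?g x))) = epow (emeasure lborel G) (1 / (1 / b))"
        by (simp only: Lpn_indicator G divide_pos_pos zero_less_one)
      also have "\<dots> \<le> epow (ennreal (8 * real N)) (1 / (1 / b))" using emG b by (intro epow_mono) auto
      finally show ?thesis by (simp add: epow_ennreal)
    next
      assume b: "b = 0 \<and> q = top"
      have "Lpn q (\<lambda>x. ennreal (norm (?g x))) \<le> 1"
        using b by (simp, intro Lpn_top_le) (auto split: split_indicator)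
      then show ?thesis using b N by simp
    qed
    have "ennreal (\<kappa> powr R * (real N * ln 2)) =
        (\<integral>\<^sup>+ x. ennreal (\<kappa> powr R / \<bar>x\<bar>) * indicator {x. 1 \<le> \<sigma> * x \<and> \<sigma> * x \<le> 2 ^ N} x \<partial>lborel)"
      using \<sigma>(1) by (intro nn_integral_inverse_two_power[symmetric]) auto
    also have "\<dots> \<le> (\<integral>\<^sup>+ x. epow (Mgamma \<gamma>1 \<gamma>2 \<psi> ?f ?g x) R \<partial>lborel)"
    proof (rule nn_integral_mono)
      fix x :: real
      show "ennreal (\<kappa> powr R / \<bar>x\<bar>) * indicator {x. 1 \<le> \<sigma> * x \<and> \<sigma> * x \<le> 2 ^ N} x
          \<le> epow (Mgamma \<gamma>1 \<gamma>2 \<psi> ?f ?g x) R"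
      proof (cases "1 \<le> \<sigma> * x \<and> \<sigma> * x \<le> 2 ^ N")
        case True
        have "1 \<le> \<bar>x\<bar>" using True \<sigma>(1) abs_ge_self[of "\<sigma> * x"] by (simp add: abs_mult)
        \<comment> \<open>Here \<open>R \<le> 1\<close> enters: the R-th power of the lower bound
          still dominates a multiple of \<open>1 / \<bar>x\<bar>\<close>, whose integral diverges
          logarithmically.\<close>
        then have "\<bar>x\<bar> powr R \<le> \<bar>x\<bar> powr 1" using R by (intro powr_mono) auto
        then have "\<kappa> powr R / \<bar>x\<bar> \<le> (\<kappa> / \<bar>x\<bar>) powr R"
          using \<open>1 \<le> \<bar>x\<bar>\<close> \<kappa> by (simp add: powr_divide frac_le)
        then have "ennreal (\<kappa> powr R / \<bar>x\<bar>) \<le> epow (ennreal (\<kappa> / \<bar>x\<bar>)) R"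
          using \<kappa> by (simp add: epow_ennreal ennreal_leI)
        also have "\<dots> \<le> epow (Mgamma \<gamma>1 \<gamma>2 \<psi> ?f ?g x) R"
          using R True by (intro epow_mono lower) auto
        finally show ?thesis using True by simp
      qed simp
    qed
    finally have "epow (ennreal (\<kappa> powr R * (real N * ln 2))) (1 / R) \<le> Lpn (ennreal R) (Mgamma \<gamma>1 \<gamma>2 \<psi> ?f ?g)"
      using R by (subst Lpn_ennreal) (auto intro!: epow_mono)
    moreover have "epow (ennreal (\<kappa> powr R * (real N * ln 2))) (1 / R) = ennreal (\<kappa> * (real N * ln 2) powr (1 / R))"
      using R \<kappa> by (simp add: epow_ennreal powr_mult powr_powr)
    ultimately have "ennreal (\<kappa> * (real N * ln 2) powr (1 / R)) \<le> Lpn (ennreal R) (Mgamma \<gamma>1 \<gamma>2 \<psi> ?f ?g)"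
      by simp
    also have "\<dots> \<le> ennreal C * Lpn (ennreal P) (\<lambda>x. ennreal (norm (?f x))) * Lpn q (\<lambda>x. ennreal (norm (?g x)))"
    proof (rule bounded)
      show "Lpn q (\<lambda>x. ennreal (norm (?g x))) < top" using g by (rule order_le_less_trans) simp
    qed (auto simp: f intro!: borel_measurable_indicator)
    also have "\<dots> \<le> ennreal (max C 0) * ennreal (2 powr (1 / P)) * ennreal ((8 * real N) powr b)"
      unfolding f by (intro mult_mono g ennreal_leI) auto
    also have "\<dots> = ennreal (D * real N powr b)"
      by (simp add: D_def ennreal_mult[symmetric] powr_mult mult.assoc)
    finally show ?thesis by (subst (asm) ennreal_le_iff) (auto simp: D_def)
  qed
  define E where "E = D / (\<kappa> * ln 2 powr (1 / R))"
  have "real N powr (1 / P) \<le> E" if N: "1 \<le> N" for N :: nat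
  proof -
    \<comment> \<open>The cost \<open>real N powr b\<close> of the centres cancels, leaving a
      positive power of \<open>N\<close> that would have to stay bounded.\<close>
    have "real N powr (1 / R) = real N powr (1 / P) * real N powr b"
      unfolding b by (rule powr_add)
    then have "(\<kappa> * ln 2 powr (1 / R) * real N powr (1 / P)) * real N powr b \<le> D * real N powr b"
      using main[OF N] by (simp add: powr_mult ac_simps)
    then have "\<kappa> * ln 2 powr (1 / R) * real N powr (1 / P) \<le> D"
      using N by (subst (asm) mult_le_cancel_right_pos) auto
    then show ?thesis using \<kappa> by (simp add: E_def field_simps)
  qed
  moreover obtain N :: nat where N: "max E 1 powr P < real N" using reals_Archimedean2 by blast
  have "1 \<le> N" using N ge_one_powr_ge_zero[of "max E 1" P] P by linarith
  moreover have "max E 1 < real N powr (1 / P)"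
    using powr_less_mono2[OF _ _ N, of "1 / P"] P by (simp add: powr_powr)
  ultimately show False by force
qed

theorem theorem1p3:
  fixes \<gamma>1 \<gamma>2 \<psi> :: "real \<Rightarrow> real"
  assumes smooth1: "smooth_on {0<..<1} \<gamma>1"
    and smooth2: "smooth_on {0<..<1} \<gamma>2"
    and regular: "\<forall>s\<in>{0<..<1}. deriv \<gamma>1 s \<noteq> 0 \<or> deriv \<gamma>2 s \<noteq> 0"
    and psi_smooth: "smooth_on UNIV \<psi>"
    and psi_supp: "compact (supp \<psi>)" "supp \<psi> \<subseteq> {0<..<1}"
    and psi_nonneg: "\<forall>s. \<psi> s \<ge> 0"
    and psi_nonzero: "\<exists>s. \<psi> s \<noteq> 0"
    and nondeg: "\<forall>s\<in>supp \<psi>. deriv \<gamma>1 s \<noteq> 0 \<and> deriv \<gamma>2 s \<noteq> 0"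
    and pq: "0 < p" "0 < q"
    and r_def: "r = inverse (inverse p + inverse q)"
  shows "(\<exists>C::real. \<forall>f g.
            f \<in> borel_measurable borel \<longrightarrow> g \<in> borel_measurable borel \<longrightarrow>
            Lpn p (\<lambda>x. ennreal (norm (f x))) < top \<longrightarrow>
            Lpn q (\<lambda>x. ennreal (norm (g x))) < top \<longrightarrow>
            Lpn r (Mgamma \<gamma>1 \<gamma>2 \<psi> f g)
              \<le> ennreal C * Lpn p (\<lambda>x. ennreal (norm (f x))) * Lpn q (\<lambda>x. ennreal (norm (g x))))
         \<longleftrightarrow> 1 < r"
proof
  have cont: "continuous_on UNIV \<psi>" using psi_smooth by (rule smooth_on_continuous_on)
  show "1 < r \<Longrightarrow> \<exists>C::real. \<forall>f g.
            f \<in> borel_measurable borel \<longrightarrow> g \<in> borel_measurable borel \<longrightarrow>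
            Lpn p (\<lambda>x. ennreal (norm (f x))) < top \<longrightarrow>
            Lpn q (\<lambda>x. ennreal (norm (g x))) < top \<longrightarrow>
            Lpn r (Mgamma \<gamma>1 \<gamma>2 \<psi> f g)
              \<le> ennreal C * Lpn p (\<lambda>x. ennreal (norm (f x))) * Lpn q (\<lambda>x. ennreal (norm (g x)))"
    by (rule Mgamma_bounded[OF smooth1 smooth2 cont psi_nonneg psi_supp nondeg pq r_def])
  assume "\<exists>C::real. \<forall>f g.
            f \<in> borel_measurable borel \<longrightarrow> g \<in> borel_measurable borel \<longrightarrow>
            Lpn p (\<lambda>x. ennreal (norm (f x))) < top \<longrightarrow>
            Lpn q (\<lambda>x. ennreal (norm (g x))) < top \<longrightarrow>
            Lpn r (Mgamma \<gamma>1 \<gamma>2 \<psi> f g)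
              \<le> ennreal C * Lpn p (\<lambda>x. ennreal (norm (f x))) * Lpn q (\<lambda>x. ennreal (norm (g x)))"
  then obtain C :: real where C: "\<And>f g.
            f \<in> borel_measurable borel \<Longrightarrow> g \<in> borel_measurable borel \<Longrightarrow>
            Lpn p (\<lambda>x. ennreal (norm (f x))) < top \<Longrightarrow>
            Lpn q (\<lambda>x. ennreal (norm (g x))) < top \<Longrightarrow>
            Lpn r (Mgamma \<gamma>1 \<gamma>2 \<psi> f g)
              \<le> ennreal C * Lpn p (\<lambda>x. ennreal (norm (f x))) * Lpn q (\<lambda>x. ennreal (norm (g x)))"
    by blast
  note unbounded = Mgamma_unbounded[OF smooth1 smooth2 cont psi_nonneg psi_nonzero psi_supp nondeg]
  show "1 < r"
  proof (rule ccontr)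
    assume "\<not> 1 < r"
    then have r: "r \<le> 1" by simp
    from pq r_def show False
    proof (cases rule: ennreal_exponent_cases)
      case (fin P Q R)
      then have "R \<le> 1" using r by simp
      show False
        by (rule unbounded[OF fin(1,3) \<open>R \<le> 1\<close> fin(4), of q C]) (use fin C in auto)
    next
      case (right_top P)
      then have "P \<le> 1" using r by simp
      show False
        by (rule unbounded[OF right_top(1,1) \<open>P \<le> 1\<close>, of 0 q C]) (use right_top C in auto)
    next
      \<comment> \<open>The counterexample requires a finite exponent on the function concentrated
        at 0. Here only \<open>q\<close> is finite, so the functions and the coordinates of the
        curve are exchanged.\<close>
      case (left_top Q)
      then have "Q \<le> 1" using r by simp
      have nondeg': "\<forall>s\<in>supp \<psi>. deriv \<gamma>2 s \<noteq> 0 \<and> deriv \<gamma>1 s \<noteq> 0" using nondeg by blast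
      have C': "Lpn r (Mgamma \<gamma>2 \<gamma>1 \<psi> g f)
              \<le> ennreal C * Lpn q (\<lambda>x. ennreal (norm (g x))) * Lpn p (\<lambda>x. ennreal (norm (f x)))"
        if "g \<in> borel_measurable borel" "f \<in> borel_measurable borel"
          "Lpn q (\<lambda>x. ennreal (norm (g x))) < top" "Lpn p (\<lambda>x. ennreal (norm (f x))) < top" for f g
        using C[of f g] that unfolding Mgamma_swap[of \<gamma>1 \<gamma>2, abs_def] by (simp add: ac_simps)
      show False
        by (rule Mgamma_unbounded[OF smooth2 smooth1 cont psi_nonneg psi_nonzero psi_supp nondeg'
              left_top(1,1) \<open>Q \<le> 1\<close>, of 0 p C]) (use left_top C' in auto)
    next
      case top
      then show False using r by (simp add: top_unique)
    qed
  qed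
qed

end
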